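(* Let $n,t\in\mathbb N$, let $G\subseteq\mathbb R[\bar X]$ be a (possibly infinite) set of polynomials such that the quadratic module $Q_G$ of $\mathbb R[\bar X]$ is archimedean, and let $f\in\mathbb R[\bar X]^{t\times t}$ (not necessarily symmetric). If for all $x\in S_G$, all real eigenvalues of $f(x)$ are positive, then $f\in Q_G^f$.
   Context: $\mathbb N=\{1,2,\dots\}$. $\mathbb R[\bar X]$ is the (commutative) polynomial ring in $n$ variables $\bar X=(X_1,\dots,X_n)$, and $\mathbb R[\bar X]^{t\times t}$ is the ring of $t\times t$ matrices over it; polynomials are identified with the corresponding scalar matrices. For $G\subseteq\mathbb R[\bar X]$: $S_G=\{x\in\mathbb R^n\mid g(x)\ge0\text{ for all }g\in G\}$, and $Q_G=\{\sum_{i=1}^Np_i^2g_i\mid N\in\mathbb N,\ g_i\in\{1\}\cup G,\ p_i\in\mathbb R[\bar X]\}$ (the quadratic module generated by $G$ in $\mathbb R[\bar X]$). $Q_G$ is archimedean if for every $a\in\mathbb R[\bar X]$ there is $N\in\mathbb N$ with $N-a^2\in Q_G$. For $f\in\mathbb R[\bar X]^{t\times t}$, $\mathbb R[\bar X,f]\subseteq\mathbb R[\bar X]^{t\times t}$ is the commutative subring generated by the scalar matrices $\mathbb R[\bar X]$ and $f$, endowed with the trivial involution, and $Q_G^f=\{\sum_{i=1}^Nh_i^2g_i\mid N\in\mathbb N,\ g_i\in\{1\}\cup G,\ h_i\in\mathbb R[\bar X,f]\}$ is the quadratic module generated by $G$ in $\mathbb R[\bar X,f]$. *)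

theory Defs
  imports "HOL-Analysis.Analysis" "HOL-Library.Poly_Mapping"
begin

text \<open>
  The polynomial ring in the variables indexed by a finite type \<open>'n\<close>: a monomial is an exponent
  vector \<open>'n \<Rightarrow>\<^sub>0 nat\<close>, and multiplication on \<open>\<Rightarrow>\<^sub>0\<close> is convolution.
\<close>

type_synonym 'n real_mpoly = "('n \<Rightarrow>\<^sub>0 nat) \<Rightarrow>\<^sub>0 real"

type_synonym ('n, 't) real_mpoly_matrix = "'n real_mpoly ^ 't ^ 't"

definition mpoly_eval :: "'n::finite real_mpoly \<Rightarrow> real ^ 'n \<Rightarrow> real" where
  "mpoly_eval p x =
     (\<Sum>m \<in> Poly_Mapping.keys p.
        Poly_Mapping.lookup p m * (\<Prod>i\<in>UNIV. (x $ i) ^ Poly_Mapping.lookup m i))"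

definition mpoly_matrix_eval ::
    "('n::finite, 't::finite) real_mpoly_matrix \<Rightarrow> real ^ 'n \<Rightarrow> real ^ 't ^ 't" where
  "mpoly_matrix_eval f x = map_matrix (\<lambda>p. mpoly_eval p x) f"

definition real_eigenvalue :: "real ^ 't ^ 't \<Rightarrow> real \<Rightarrow> bool" where
  "real_eigenvalue A c \<longleftrightarrow> (\<exists>v. v \<noteq> 0 \<and> A *v v = c *s v)"

definition nonneg_set :: "'n::finite real_mpoly set \<Rightarrow> (real ^ 'n) set" where
  "nonneg_set G = {x. \<forall>g\<in>G. mpoly_eval g x \<ge> 0}"

definition quadratic_module :: "'n::finite real_mpoly set \<Rightarrow> 'n real_mpoly set" where
  "quadratic_module G =
     {(\<Sum>i=1..N. (p i)\<^sup>2 * g i) | (N::nat) p g. 1 \<le> N \<and> (\<forall>i\<in>{1..N}. g i \<in> insert 1 G)}"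

definition archimedean_module :: "'n::finite real_mpoly set \<Rightarrow> bool" where
  "archimedean_module Q \<longleftrightarrow> (\<forall>a. \<exists>N::nat. 1 \<le> N \<and> of_nat N - a\<^sup>2 \<in> Q)"

text \<open>
  The subring of the matrix ring generated by the scalar matrices \<open>mat p\<close> and \<open>f\<close>. The ring
  product of matrices is \<open>**\<close>; the operations \<open>*\<close> and \<open>^\<close> on vectors act componentwise.
\<close>

inductive_set adjoin ::
    "('n::finite, 't::finite) real_mpoly_matrix \<Rightarrow> ('n, 't) real_mpoly_matrix set"
  for f :: "('n::finite, 't::finite) real_mpoly_matrix" where
  scalar: "mat p \<in> adjoin f"
| gen: "f \<in> adjoin f"
| add: "a \<in> adjoin f \<Longrightarrow> b \<in> adjoin f \<Longrightarrow> a + b \<in> adjoin f"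
| uminus: "a \<in> adjoin f \<Longrightarrow> - a \<in> adjoin f"
| mult: "a \<in> adjoin f \<Longrightarrow> b \<in> adjoin f \<Longrightarrow> a ** b \<in> adjoin f"

definition quadratic_module_adjoin ::
    "('n::finite, 't::finite) real_mpoly_matrix \<Rightarrow> 'n real_mpoly set
      \<Rightarrow> ('n, 't) real_mpoly_matrix set" where
  "quadratic_module_adjoin f G =
     {(\<Sum>i=1..N. (h i ** h i) ** mat (g i)) | (N::nat) h g.
        1 \<le> N \<and> (\<forall>i\<in>{1..N}. h i \<in> adjoin f \<and> g i \<in> insert 1 G)}"

end

theory Submission
  imports Defs "HOL-Computational_Algebra.Polynomial"
begin

text \<open>
  The commutative ring \<open>\<real>[X, f]\<close> is a quotient of \<open>\<real>[X][Y]\<close> via \<open>Y \<mapsto> f\<close>; let \<open>M\<close> be the preimage in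
  \<open>\<real>[X][Y]\<close> of \<open>Q_G^f\<close>. By Cayley-Hamilton the monic characteristic polynomial \<open>\<chi>(Y)\<close> of \<open>f\<close> and its
  negative lie in \<open>M\<close>. Hence \<open>Y\<close> is integral over the bounded elements \<open>\<real>[X]\<close> modulo \<open>M\<close>, which makes
  \<open>Y\<close> bounded and \<open>M\<close> Archimedean. A homomorphism \<open>\<alpha>\<close> to the reals that is nonnegative on \<open>M\<close> is
  evaluation at a point \<open>x \<in> S_G\<close> on \<open>\<real>[X]\<close>, and \<open>\<alpha> Y\<close> is a root of the characteristic polynomial of
  \<open>f(x)\<close>, that is, a real eigenvalue of \<open>f(x)\<close>. So \<open>Y\<close> is positive under every such \<open>\<alpha>\<close>, and Jacobi's
  Positivstellensatz for Archimedean quadratic modules gives \<open>Y \<in> M\<close>. The latter follows from the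
  fact that a maximal proper quadratic module \<open>Q\<close> that is Archimedean defines the homomorphism
  \<open>a \<mapsto> Sup {r. a - r \<in> Q}\<close>.
\<close>

section \<open>Quadratic modules in commutative rings\<close>

definition qmodule :: "'a::comm_ring_1 set \<Rightarrow> bool" where
  "qmodule M \<longleftrightarrow> 1 \<in> M \<and> (\<forall>a\<in>M. \<forall>b\<in>M. a + b \<in> M) \<and> (\<forall>a. \<forall>b\<in>M. a\<^sup>2 * b \<in> M)"

lemma qmodule_one: "qmodule M \<Longrightarrow> 1 \<in> M"
  and qmodule_add: "qmodule M \<Longrightarrow> a \<in> M \<Longrightarrow> b \<in> M \<Longrightarrow> a + b \<in> M"
  and qmodule_mult_square: "qmodule M \<Longrightarrow> b \<in> M \<Longrightarrow> a\<^sup>2 * b \<in> M"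
  by (auto simp: qmodule_def)

lemma qmodule_square: "qmodule M \<Longrightarrow> a\<^sup>2 \<in> M"
  using qmodule_mult_square[of M 1 a] by (simp add: qmodule_one)

lemma even_power_mem: "qmodule M \<Longrightarrow> a ^ (2 * k) \<in> M"
  using qmodule_square[of M "a ^ k"] by (simp add: power_even_eq)

lemma qmodule_zero: "qmodule M \<Longrightarrow> 0 \<in> M"
  using qmodule_square[of M 0] by simp

lemma qmodule_sum:
  assumes "qmodule M" "\<And>i. i \<in> I \<Longrightarrow> h i \<in> M"
  shows "sum h I \<in> M"
  using assms(2) by (induction I rule: infinite_finite_induct)
    (auto intro: qmodule_add[OF assms(1)] qmodule_zero[OF assms(1)])

section \<open>Generated quadratic modules and adjoining an element\<close>

inductive_set qgen :: "'a::comm_ring_1 set \<Rightarrow> 'a set" for B where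
  zero: "0 \<in> qgen B"
| base: "b \<in> insert 1 B \<Longrightarrow> p\<^sup>2 * b \<in> qgen B"
| add: "a \<in> qgen B \<Longrightarrow> b \<in> qgen B \<Longrightarrow> a + b \<in> qgen B"

lemma qgen_generator: "b \<in> insert 1 B \<Longrightarrow> b \<in> qgen B"
  using qgen.base[of b B 1] by simp

lemma qmodule_qgen: "qmodule (qgen B)"
proof -
  have "a\<^sup>2 * b \<in> qgen B" if "b \<in> qgen B" for a b
    using that
  proof (induction rule: qgen.induct)
    case (base b p)
    then show ?case
      using qgen.base[of b B "a * p"] by (simp add: power_mult_distrib mult.assoc)
  qed (auto simp: distrib_left intro: qgen.zero qgen.add)
  then show ?thesis
    by (auto simp: qmodule_def intro: qgen.add qgen_generator)
qed

text \<open>With no generators only \<open>b = 1\<close> remains in \<open>base\<close>, so these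
  are exactly the finite sums of squares.\<close>

abbreviation sos :: "'a::comm_ring_1 set" where
  "sos \<equiv> qgen {}"

lemma sos_mult:
  assumes "qmodule M" "s \<in> sos" "a \<in> M"
  shows "s * a \<in> M"
  using assms(2)
proof (induction rule: qgen.induct)
  case (base b p)
  then show ?case
    by (simp add: qmodule_mult_square[OF assms(1) assms(3)])
qed (auto simp: distrib_right intro: qmodule_add[OF assms(1)] qmodule_zero[OF assms(1)])

lemma sos_subset: "qmodule M \<Longrightarrow> s \<in> sos \<Longrightarrow> s \<in> M"
  using sos_mult[of M s 1] by (simp add: qmodule_one)

text \<open>Multiplication by a square preserves both summands. When \<open>- 1\<close> falls into
  such an extension, the certificate \<open>- 1 = m + a * s\<close> becomes available.\<close>

lemma qmodule_adjoin:
  assumes "qmodule M"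
  shows "qmodule {m + a * s | m s. m \<in> M \<and> s \<in> sos}" (is "qmodule ?A")
  unfolding qmodule_def
proof (intro conjI ballI allI)
  have "1 = 1 + a * 0"
    by simp
  then show "1 \<in> ?A"
    using qmodule_one[OF assms] qgen.zero by blast
next
  fix x y assume "x \<in> ?A" "y \<in> ?A"
  then obtain m s m' s' where
    "x = m + a * s" "m \<in> M" "s \<in> sos" "y = m' + a * s'" "m' \<in> M" "s' \<in> sos"
    by blast
  moreover from this have "x + y = (m + m') + a * (s + s')"
    by (simp add: algebra_simps)
  ultimately show "x + y \<in> ?A"
    using qmodule_add[OF assms] qgen.add by blast
next
  fix c x assume "x \<in> ?A"
  then obtain m s where "x = m + a * s" "m \<in> M" "s \<in> sos"
    by blast
  moreover from this have "c\<^sup>2 * x = c\<^sup>2 * m + a * (c\<^sup>2 * s)"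
    by (simp add: algebra_simps)
  ultimately show "c\<^sup>2 * x \<in> ?A"
    using qmodule_mult_square[OF assms] qmodule_mult_square[OF qmodule_qgen] by blast
qed

lemma qmodule_adjoin_superset: "M \<subseteq> {m + a * s | m s. m \<in> M \<and> s \<in> sos}"
proof
  fix m assume "m \<in> M"
  moreover have "m = m + a * 0"
    by simp
  ultimately show "m \<in> {m + a * s | m s. m \<in> M \<and> s \<in> sos}"
    using qgen.zero by blast
qed

text \<open>Zorn's lemma applies because properness concerns a single element: \<open>- 1\<close>
  lies in the union of a chain only if it lies in one of its members.\<close>

lemma qmodule_maximal_exists:
  assumes "qmodule M" "- 1 \<notin> M"
  obtains Q where "qmodule Q" "M \<subseteq> Q" "- 1 \<notin> Q"
    "\<And>Q'. qmodule Q' \<Longrightarrow> Q \<subseteq> Q' \<Longrightarrow> - 1 \<notin> Q' \<Longrightarrow> Q' = Q"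
proof -
  define \<A> where "\<A> = {Q. qmodule Q \<and> M \<subseteq> Q \<and> - 1 \<notin> Q}"
  have "\<exists>Q\<in>\<A>. \<forall>X\<in>\<A>. Q \<subseteq> X \<longrightarrow> X = Q"
  proof (rule subset_Zorn_nonempty)
    show "\<A> \<noteq> {}"
      using assms by (auto simp: \<A>_def)
  next
    fix \<C> assume C: "\<C> \<noteq> {}" "subset.chain \<A> \<C>"
    then have sub: "\<C> \<subseteq> \<A>" and tot: "\<And>X Y. X \<in> \<C> \<Longrightarrow> Y \<in> \<C> \<Longrightarrow> X \<subseteq> Y \<or> Y \<subseteq> X"
      by (auto simp: subset.chain_def)
    have add: "a + b \<in> \<Union>\<C>" if ab: "a \<in> \<Union>\<C>" "b \<in> \<Union>\<C>" for a b
    proof -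
      obtain X Y where "X \<in> \<C>" "Y \<in> \<C>" "a \<in> X" "b \<in> Y"
        using ab by blast
      then obtain Z where "Z \<in> \<C>" "a \<in> Z" "b \<in> Z"
        using tot by blast
      moreover from this have "qmodule Z"
        using sub by (auto simp: \<A>_def)
      ultimately have "a + b \<in> Z"
        by (auto intro: qmodule_add)
      then show ?thesis
        using \<open>Z \<in> \<C>\<close> by blast
    qed
    have "1 \<in> \<Union>\<C>"
      using C(1) sub qmodule_one by (fastforce simp: \<A>_def)
    moreover have "a\<^sup>2 * b \<in> \<Union>\<C>" if "b \<in> \<Union>\<C>" for a b
      using that sub qmodule_mult_square by (fastforce simp: \<A>_def)
    ultimately have "qmodule (\<Union>\<C>)"
      using add by (auto simp: qmodule_def)
    moreover have "M \<subseteq> \<Union>\<C>"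
      using C(1) sub by (fastforce simp: \<A>_def)
    moreover have "- 1 \<notin> \<Union>\<C>"
      using sub by (auto simp: \<A>_def)
    ultimately show "\<Union>\<C> \<in> \<A>"
      by (simp add: \<A>_def)
  qed
  then obtain Q where Q: "Q \<in> \<A>" "\<And>X. X \<in> \<A> \<Longrightarrow> Q \<subseteq> X \<Longrightarrow> X = Q"
    by blast
  show ?thesis
  proof (rule that)
    show "qmodule Q" "M \<subseteq> Q" "- 1 \<notin> Q"
      using Q(1) by (auto simp: \<A>_def)
    then show "Q' = Q" if "qmodule Q'" "Q \<subseteq> Q'" "- 1 \<notin> Q'" for Q'
      using that Q(2)[of Q'] by (auto simp: \<A>_def)
  qed
qed

section \<open>The Positivstellensatz for Archimedean quadratic modules\<close>

text \<open>The real algebra structure is an explicit map, so that it can be instantiated with the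
  constants of a polynomial ring whose coefficients are themselves polynomials.\<close>

locale real_scalars =
  fixes \<iota> :: "real \<Rightarrow> 'a::comm_ring_1"
  assumes scalar_add: "\<iota> (r + s) = \<iota> r + \<iota> s"
    and scalar_mult: "\<iota> (r * s) = \<iota> r * \<iota> s"
    and scalar_one: "\<iota> 1 = 1"
begin

section \<open>Scalars and the support of a quadratic module\<close>

lemma scalar_zero: "\<iota> 0 = 0"
  using scalar_add[of 0 0] by simp

lemma scalar_uminus: "\<iota> (- r) = - \<iota> r"
  using scalar_add[of r "- r"] by (simp add: scalar_zero eq_neg_iff_add_eq_0 add.commute)

lemma scalar_diff: "\<iota> (r - s) = \<iota> r - \<iota> s"
  using scalar_add[of r "- s"] by (simp add: scalar_uminus)

lemma scalar_power: "\<iota> (r ^ n) = \<iota> r ^ n"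
  by (induction n) (auto simp: scalar_one scalar_mult)

lemma scalar_half: "\<iota> (1/2) + \<iota> (1/2) = 1"
  by (simp add: scalar_one flip: scalar_add)

lemma scalar_mult_mem:
  assumes "qmodule M" "0 \<le> r" "a \<in> M"
  shows "\<iota> r * a \<in> M"
proof -
  have "\<iota> r = (\<iota> (sqrt r))\<^sup>2"
    using assms(2) by (simp flip: scalar_power)
  then show ?thesis
    using qmodule_mult_square[OF assms(1,3)] by simp
qed

lemma scalar_mem: "qmodule M \<Longrightarrow> 0 \<le> r \<Longrightarrow> \<iota> r \<in> M"
  using scalar_mult_mem[of M r 1] by (simp add: qmodule_one)

text \<open>A negative scalar in \<open>M\<close> could be rescaled by a positive one to
  \<open>- 1\<close>.\<close>

lemma scalar_mem_nonneg:
  assumes "qmodule M" "- 1 \<notin> M" "\<iota> r \<in> M"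
  shows "0 \<le> r"
proof (rule ccontr)
  assume "\<not> 0 \<le> r"
  then have "\<iota> (- inverse r) * \<iota> r \<in> M"
    using assms by (intro scalar_mult_mem) auto
  moreover have "\<iota> (- inverse r) * \<iota> r = - 1"
    using \<open>\<not> 0 \<le> r\<close> by (simp add: scalar_uminus scalar_one flip: scalar_mult)
  ultimately show False
    using assms by simp
qed

text \<open>The identity \<open>4 * a = (a + 1)^2 - (a - 1)^2\<close> expresses \<open>a * x\<close>
  through \<open>x\<close> and \<open>- x\<close> with squares as multipliers; \<open>h\<close> is
  the scalar one half.\<close>

lemma support_ideal:
  fixes a :: 'a
  assumes "qmodule M" "x \<in> M" "- x \<in> M"
  shows "a * x \<in> M"
proof -
  define h where "h = \<iota> (1/2)"
  have "h + h = 1"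
    using scalar_half by (simp add: h_def)
  then have "a * x = (h + h) * (h + h) * (a * x)"
    by simp
  also have "\<dots> = (h * (a + 1))\<^sup>2 * x + (h * (a - 1))\<^sup>2 * (- x)"
    by (simp only: power2_eq_square) (simp add: algebra_simps)
  finally have "a * x = (h * (a + 1))\<^sup>2 * x + (h * (a - 1))\<^sup>2 * (- x)" .
  also have "\<dots> \<in> M"
    by (intro qmodule_add qmodule_mult_square assms)
  finally show ?thesis .
qed

text \<open>If both signs of \<open>a\<close> were missing, maximality would put \<open>- 1\<close>
  into both extensions of \<open>Q\<close>. Combining the two certificates places the sum of squares
  \<open>s\<close> in the support of \<open>Q\<close>, and then \<open>- 1 = m + a * s\<close> lies
  in \<open>Q\<close>.\<close>

lemma qmodule_maximal_total:
  fixes Q :: "'a set"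
  assumes Q: "qmodule Q" "- 1 \<notin> Q"
    and max: "\<And>Q'. qmodule Q' \<Longrightarrow> Q \<subseteq> Q' \<Longrightarrow> - 1 \<notin> Q' \<Longrightarrow> Q' = Q"
  shows "a \<in> Q \<or> - a \<in> Q"
proof (rule ccontr)
  assume contra: "\<not> (a \<in> Q \<or> - a \<in> Q)"
  have *: "\<exists>m s. m \<in> Q \<and> s \<in> sos \<and> - 1 = m + b * s" if "b \<notin> Q" for b
  proof -
    let ?A = "{m + b * s | m s. m \<in> Q \<and> s \<in> sos}"
    have "b = 0 + b * 1"
      by simp
    then have "b \<in> ?A"
      using qmodule_zero[OF Q(1)] qgen_generator[of 1 "{}"] by blast
    then have "?A \<noteq> Q"
      using that by blast
    then have "- 1 \<in> ?A"
      using max[of ?A] qmodule_adjoin[OF Q(1)] qmodule_adjoin_superset by blast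
    then show ?thesis
      by blast
  qed
  obtain m s where ms: "m \<in> Q" "s \<in> sos" "- 1 = m + a * s"
    using *[of a] contra by blast
  obtain m' s' where ms': "m' \<in> Q" "s' \<in> sos" "- 1 = m' + - a * s'"
    using *[of "- a"] contra by blast
  have as: "a * s = - 1 - m" "a * s' = m' - (- 1)"
    subgoal unfolding ms(3) by simp
    subgoal unfolding ms'(3) by simp
    done
  \<comment> \<open>Evaluating this product through either certificate eliminates
    \<open>a\<close>.\<close>
  have "s * (a * s') = s' * (a * s)"
    by (simp add: algebra_simps)
  then have "s * (m' - (- 1)) = s' * (- 1 - m)"
    unfolding as .
  then have "- s = s' + s' * m + s * m'"
    by (simp add: algebra_simps) (simp add: eq_neg_iff_add_eq_0 neg_eq_iff_add_eq_0 algebra_simps)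
  also have "\<dots> \<in> Q"
    using ms ms' sos_subset[OF Q(1)] by (intro qmodule_add[OF Q(1)] sos_mult[OF Q(1)]) auto
  finally have "- s \<in> Q" .
  \<comment> \<open>Now both \<open>s\<close> and \<open>- s\<close> are in \<open>Q\<close>, so
    every multiple of \<open>s\<close> is in \<open>Q\<close>.\<close>
  then have "m + a * s \<in> Q"
    using ms(1,2) sos_subset[OF Q(1)] by (intro qmodule_add[OF Q(1)] support_ideal[OF Q(1)])
  then show False
    using ms(3) Q(2) by simp
qed

text \<open>Applied to \<open>a\<close> and to \<open>- a\<close>, the one-sided bound encloses
  every element between two scalars.\<close>

definition archimedean :: "'a set \<Rightarrow> bool" where
  "archimedean M \<longleftrightarrow> (\<forall>a. \<exists>N. \<iota> N - a \<in> M)"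

text \<open>Unitality is the third clause at \<open>r = 1\<close>.\<close>

definition real_hom :: "('a \<Rightarrow> real) \<Rightarrow> bool" where
  "real_hom \<alpha> \<longleftrightarrow> (\<forall>a b. \<alpha> (a + b) = \<alpha> a + \<alpha> b) \<and> (\<forall>a b. \<alpha> (a * b) = \<alpha> a * \<alpha> b)
     \<and> (\<forall>r. \<alpha> (\<iota> r) = r)"

text \<open>Totality makes each element define a Dedekind cut of the reals, whose value is
  \<open>\<alpha> a\<close>. Additivity is read off the cuts; multiplicativity follows from
  compatibility with squares, which reduces to elements of value zero.\<close>

theorem maximal_qmodule_real_hom:
  assumes Q: "qmodule Q" "- 1 \<notin> Q" and arch: "archimedean Q"
    and total: "\<And>a. a \<in> Q \<or> - a \<in> Q"
  obtains \<alpha> where "real_hom \<alpha>" "\<And>a. a \<in> Q \<Longrightarrow> 0 \<le> \<alpha> a"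
proof -
  note add = qmodule_add[OF Q(1)]
  define \<alpha> where "\<alpha> a = Sup {r. a - \<iota> r \<in> Q}" for a
  have below: "r \<le> \<alpha> a" if "a - \<iota> r \<in> Q" for r a
  proof -
    obtain N where N: "\<iota> N - a \<in> Q"
      using arch by (auto simp: archimedean_def)
    have "s \<le> N" if "a - \<iota> s \<in> Q" for s
      using scalar_mem_nonneg[OF Q, of "N - s"] add[OF N that] by (simp add: scalar_diff)
    then have "bdd_above {r. a - \<iota> r \<in> Q}"
      by (intro bdd_aboveI[of _ N]) auto
    then show ?thesis
      using that by (auto simp: \<alpha>_def intro: cSup_upper)
  qed
  have above: "\<alpha> a \<le> r" if r: "\<iota> r - a \<in> Q" for r a
  proof -
    obtain N where N: "\<iota> N - (- a) \<in> Q"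
      using arch by (auto simp only: archimedean_def)
    then have "a - \<iota> (- N) \<in> Q"
      by (simp add: scalar_uminus add.commute)
    moreover have "s \<le> r" if "a - \<iota> s \<in> Q" for s
      using scalar_mem_nonneg[OF Q, of "r - s"] add[OF r that] by (simp add: scalar_diff)
    ultimately show ?thesis
      unfolding \<alpha>_def by (intro cSup_least) auto
  qed
  \<comment> \<open>The converses of \<open>below\<close> and \<open>above\<close> hold only for
    strict inequalities: if the element were not in \<open>Q\<close>, totality would put its
    negative there and contradict strictness.\<close>
  have below': "a - \<iota> r \<in> Q" if "r < \<alpha> a" for r a
    using total[of "a - \<iota> r"] above[of r a] that by auto
  have above': "\<iota> r - a \<in> Q" if "\<alpha> a < r" for r a
    using total[of "a - \<iota> r"] below[of a r] that by auto
  have eqI: "\<alpha> a = c"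
    if lo: "\<And>e. 0 < e \<Longrightarrow> a - \<iota> (c - e) \<in> Q" and hi: "\<And>e. 0 < e \<Longrightarrow> \<iota> (c + e) - a \<in> Q" for a c
  proof (rule antisym)
    show "\<alpha> a \<le> c"
      by (rule field_le_epsilon) (rule above[OF hi])
    have "c \<le> \<alpha> a + e" if "0 < e" for e
      using below[OF lo[OF that]] by simp
    then show "c \<le> \<alpha> a"
      by (rule field_le_epsilon)
  qed
  have hom_scalar: "\<alpha> (\<iota> r) = r" for r
    by (rule eqI) (auto simp flip: scalar_diff intro: scalar_mem[OF Q(1)])
  have hom_add: "\<alpha> (a + b) = \<alpha> a + \<alpha> b" for a b
  proof (rule eqI)
    fix e :: real assume "0 < e"
    have "(a - \<iota> (\<alpha> a - e/2)) + (b - \<iota> (\<alpha> b - e/2)) \<in> Q"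
      using \<open>0 < e\<close> by (intro add below') auto
    also have "(a - \<iota> (\<alpha> a - e/2)) + (b - \<iota> (\<alpha> b - e/2))
        = a + b - \<iota> ((\<alpha> a - e/2) + (\<alpha> b - e/2))"
      by (simp only: scalar_add) (simp add: algebra_simps)
    finally show "a + b - \<iota> (\<alpha> a + \<alpha> b - e) \<in> Q"
      by (simp add: algebra_simps)
    have "(\<iota> (\<alpha> a + e/2) - a) + (\<iota> (\<alpha> b + e/2) - b) \<in> Q"
      using \<open>0 < e\<close> by (intro add above') auto
    also have "(\<iota> (\<alpha> a + e/2) - a) + (\<iota> (\<alpha> b + e/2) - b)
        = \<iota> ((\<alpha> a + e/2) + (\<alpha> b + e/2)) - (a + b)"
      by (simp only: scalar_add) (simp add: algebra_simps)
    finally show "\<iota> (\<alpha> a + \<alpha> b + e) - (a + b) \<in> Q"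
      by (simp add: algebra_simps)
  qed
  have hom_minus: "\<alpha> (- a) = - \<alpha> a" for a
    using hom_add[of a "- a"] hom_scalar[of 0] by (simp add: scalar_zero)
  have hom_diff: "\<alpha> (a - b) = \<alpha> a - \<alpha> b" for a b
    using hom_add[of a "- b"] by (simp add: hom_minus)
  have nonneg: "0 \<le> \<alpha> a" if "a \<in> Q" for a
    using below[of a 0] that by (simp add: scalar_zero)
  have null: "\<alpha> (a\<^sup>2) = 0" if "\<alpha> a = 0" for a
  proof (rule antisym)
    show "0 \<le> \<alpha> (a\<^sup>2)"
      by (intro nonneg qmodule_square Q)
    show "\<alpha> (a\<^sup>2) \<le> 0"
    proof (rule field_le_epsilon)
      fix e :: real assume "0 < e"
      \<comment> \<open>Both \<open>d - a\<close> and \<open>d + a\<close> lie in \<open>Q\<close>,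
        but \<open>Q\<close> need not contain their product. The identity \<open>(d + a)^2 * (d - a)
        + (d - a)^2 * (d + a) = 2 * d * (d^2 - a^2)\<close> yields it with square multipliers
        only.\<close>
      define d where "d = sqrt e"
      have d: "0 < d" "d\<^sup>2 = e"
        using \<open>0 < e\<close> by (auto simp: d_def)
      have "\<iota> d - a \<in> Q"
        using above'[of a d] d that by simp
      moreover have "\<iota> d + a \<in> Q"
        using below'[of "- d" a] d that by (simp add: scalar_uminus add.commute)
      ultimately have "\<iota> (1 / (2 * d)) * ((\<iota> d + a)\<^sup>2 * (\<iota> d - a) + (\<iota> d - a)\<^sup>2 * (\<iota> d + a)) \<in> Q"
        using d by (intro scalar_mult_mem[OF Q(1)] add[OF qmodule_mult_square qmodule_mult_square] Q(1)) auto
      also have "(\<iota> d + a)\<^sup>2 * (\<iota> d - a) + (\<iota> d - a)\<^sup>2 * (\<iota> d + a)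
          = (\<iota> d + \<iota> d) * ((\<iota> d)\<^sup>2 - a\<^sup>2)"
        by (simp only: power2_eq_square) (simp add: algebra_simps)
      also have "\<iota> (1 / (2 * d)) * ((\<iota> d + \<iota> d) * ((\<iota> d)\<^sup>2 - a\<^sup>2))
          = \<iota> (1 / (2 * d) * (d + d)) * (\<iota> (d\<^sup>2) - a\<^sup>2)"
        by (simp only: scalar_add scalar_mult scalar_power mult.assoc)
      also have "1 / (2 * d) * (d + d) = 1"
        using d by (simp add: field_simps)
      finally have "\<iota> e - a\<^sup>2 \<in> Q"
        by (simp add: scalar_one d)
      then show "\<alpha> (a\<^sup>2) \<le> 0 + e"
        using above by simp
    qed
  qed
  have hom_scale_pos: "\<alpha> (\<iota> r * a) = r * \<alpha> a" if "0 < r" for r a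
  proof (rule eqI)
    fix e :: real assume "0 < e"
    have "\<iota> r * (a - \<iota> (\<alpha> a - e/r)) \<in> Q" "\<iota> r * (\<iota> (\<alpha> a + e/r) - a) \<in> Q"
      using that \<open>0 < e\<close> by (auto intro!: scalar_mult_mem Q below' above')
    moreover have "\<iota> r * (a - \<iota> x) = \<iota> r * a - \<iota> (r * x)" "\<iota> r * (\<iota> x - a) = \<iota> (r * x) - \<iota> r * a" for x
      by (simp_all add: scalar_mult algebra_simps)
    moreover have "r * (\<alpha> a - e/r) = r * \<alpha> a - e" "r * (\<alpha> a + e/r) = r * \<alpha> a + e"
      using that by (simp_all add: field_simps)
    ultimately show "\<iota> r * a - \<iota> (r * \<alpha> a - e) \<in> Q" "\<iota> (r * \<alpha> a + e) - \<iota> r * a \<in> Q"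
      by simp_all
  qed
  have hom_scale: "\<alpha> (\<iota> r * a) = r * \<alpha> a" for r a
    using hom_scale_pos[of r a] hom_scale_pos[of "- r" a] hom_scalar[of 0]
    by (cases r "0::real" rule: linorder_cases) (auto simp: scalar_zero scalar_uminus hom_minus)
  have hom_square: "\<alpha> (a\<^sup>2) = (\<alpha> a)\<^sup>2" for a
  proof -
    \<comment> \<open>Centering \<open>a\<close> at its value leaves a square of value zero and an
      expression linear in \<open>a\<close>.\<close>
    have "a\<^sup>2 = (a - \<iota> (\<alpha> a))\<^sup>2 + (\<iota> (2 * \<alpha> a) * a - \<iota> ((\<alpha> a)\<^sup>2))"
      using scalar_add[of "\<alpha> a" "\<alpha> a"] by (simp add: scalar_mult power2_eq_square algebra_simps)
    moreover have "\<alpha> ((a - \<iota> (\<alpha> a))\<^sup>2) = 0"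
      by (intro null) (simp add: hom_diff hom_scalar)
    ultimately show ?thesis
      by (simp add: hom_add hom_diff hom_scale hom_scalar power2_eq_square)
  qed
  have hom_mult: "\<alpha> (a * b) = \<alpha> a * \<alpha> b" for a b
  proof -
    \<comment> \<open>Polarization recovers products from squares.\<close>
    have "(a + b)\<^sup>2 = a\<^sup>2 + b\<^sup>2 + (a * b + a * b)"
      by (simp add: power2_eq_square algebra_simps)
    then have "\<alpha> ((a + b)\<^sup>2) = (\<alpha> a)\<^sup>2 + (\<alpha> b)\<^sup>2 + (\<alpha> (a * b) + \<alpha> (a * b))"
      by (simp only: hom_add hom_square)
    then have "(\<alpha> a + \<alpha> b)\<^sup>2 = (\<alpha> a)\<^sup>2 + (\<alpha> b)\<^sup>2 + (\<alpha> (a * b) + \<alpha> (a * b))"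
      by (simp only: hom_add hom_square)
    then show ?thesis
      by (simp add: power2_eq_square algebra_simps)
  qed
  show ?thesis
    using that[of \<alpha>] hom_add hom_mult hom_scalar nonneg by (auto simp: real_hom_def)
qed

text \<open>If adjoining \<open>- f\<close> left \<open>M\<close> proper, a maximal extension would
  give a homomorphism with \<open>\<alpha> f \<le> 0\<close>. Hence \<open>g * f - 1\<close> is in
  \<open>M\<close> for some sum of squares \<open>g\<close>, and the rest of the proof removes the
  multiplier \<open>g\<close>.\<close>

theorem positivstellensatz:
  fixes M :: "'a set"
  assumes M: "qmodule M" and arch: "archimedean M"
    and pos: "\<And>\<alpha>. real_hom \<alpha> \<Longrightarrow> (\<And>a. a \<in> M \<Longrightarrow> 0 \<le> \<alpha> a) \<Longrightarrow> 0 < \<alpha> f"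
  shows "f \<in> M"
proof -
  let ?A = "{m + (- f) * s | m s. m \<in> M \<and> s \<in> sos}"
  have "- 1 \<in> ?A"
  proof (rule ccontr)
    assume "- 1 \<notin> ?A"
    then obtain Q where Q: "qmodule Q" "?A \<subseteq> Q" "- 1 \<notin> Q"
        "\<And>Q'. qmodule Q' \<Longrightarrow> Q \<subseteq> Q' \<Longrightarrow> - 1 \<notin> Q' \<Longrightarrow> Q' = Q"
      using qmodule_maximal_exists[OF qmodule_adjoin[OF M, of "- f"]] by blast
    have "M \<subseteq> Q"
      using qmodule_adjoin_superset Q(2) by blast
    then have "archimedean Q"
      using arch unfolding archimedean_def by blast
    then obtain \<alpha> where \<alpha>: "real_hom \<alpha>" "\<And>a. a \<in> Q \<Longrightarrow> 0 \<le> \<alpha> a"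
      using maximal_qmodule_real_hom[OF Q(1,3)] qmodule_maximal_total[OF Q(1,3,4)] by blast
    have "- f = 0 + (- f) * 1"
      by simp
    then have "- f \<in> Q"
      using Q(2) qmodule_zero[OF M] qgen_generator[of 1 "{}"] by blast
    then have "0 \<le> \<alpha> (- f)"
      by (rule \<alpha>(2))
    moreover have "\<alpha> (- f) + \<alpha> f = \<alpha> (\<iota> 0)"
      using \<alpha>(1) by (simp add: real_hom_def scalar_zero flip: \<alpha>(1)[unfolded real_hom_def, THEN conjunct1, rule_format])
    moreover have "\<alpha> (\<iota> 0) = 0"
      using \<alpha>(1) by (simp add: real_hom_def)
    moreover have "0 < \<alpha> f"
      using pos[OF \<alpha>(1)] \<alpha>(2) \<open>M \<subseteq> Q\<close> by blast
    ultimately show False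
      by simp
  qed
  then obtain m g where mg: "- 1 = m + (- f) * g" "m \<in> M" and g: "g \<in> sos"
    by blast
  have gf: "g * f - 1 \<in> M"
  proof -
    have "g * f - 1 = g * f + (m + (- f) * g)"
      unfolding mg(1)[symmetric] by simp
    then show ?thesis
      using mg(2) by (simp add: algebra_simps)
  qed
  obtain N1 N2 where N: "\<iota> N1 - g \<in> M" "\<iota> N2 - g\<^sup>2 * f \<in> M"
    using arch unfolding archimedean_def by blast
  \<comment> \<open>Chosen so that \<open>k\<close> is positive, \<open>2 * k\<close> bounds
    \<open>g\<close> and \<open>2 * k - 1\<close> bounds \<open>g^2 * f\<close>.\<close>
  define k where "k = max 1 (max N1 (N2 + 1))"
  have "1 \<le> k" "N1 \<le> k" "N2 + 1 \<le> k"
    by (auto simp: k_def)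
  then have k: "0 < k" "N1 \<le> 2 * k" "N2 \<le> 2 * k - 1"
    by linarith+
  have up: "\<iota> s - a \<in> M" if "\<iota> r - a \<in> M" "r \<le> s" for r s a
    using qmodule_add[OF M that(1) scalar_mem[OF M, of "s - r"]] that(2) by (simp add: scalar_diff)
  have kg: "\<iota> (2 * k) - g \<in> M" "\<iota> (2 * k - 1) - g\<^sup>2 * f \<in> M"
    using up N k by blast+
  \<comment> \<open>Woermann's trick: \<open>f + r\<close> stays in \<open>M\<close> when \<open>r\<close> is lowered by a fixed amount.\<close>
  have step: "f + \<iota> (r - 1 / k\<^sup>2) \<in> M" if r: "0 \<le> r" "f + \<iota> r \<in> M" for r
  proof -
    \<comment> \<open>The last three summands cancel every term containing \<open>g\<close> in the
      expansion of the first, leaving \<open>k^2 * (f + r) - 1\<close>. The third is in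
      \<open>M\<close> because \<open>r\<close> is nonnegative and \<open>g\<close> is a sum of
      squares.\<close>
    have "(\<iota> k - g)\<^sup>2 * (f + \<iota> r) + \<iota> (2 * k) * (g * f - 1) + \<iota> r * (g * (\<iota> (2 * k) - g))
        + (\<iota> (2 * k - 1) - g\<^sup>2 * f) \<in> M"
      using k by (intro qmodule_add[OF M] qmodule_mult_square[OF M] scalar_mult_mem[OF M] sos_mult[OF M] g
          kg gf r) simp
    also have "(\<iota> k - g)\<^sup>2 * (f + \<iota> r) + \<iota> (2 * k) * (g * f - 1) + \<iota> r * (g * (\<iota> (2 * k) - g))
        + (\<iota> (2 * k - 1) - g\<^sup>2 * f) = (\<iota> k)\<^sup>2 * (f + \<iota> r) - 1"
      using scalar_add[of k k] by (simp add: scalar_diff scalar_one power2_eq_square algebra_simps)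
    finally have "\<iota> (1 / k\<^sup>2) * ((\<iota> k)\<^sup>2 * (f + \<iota> r) - 1) \<in> M"
      by (intro scalar_mult_mem[OF M]) auto
    also have "\<iota> (1 / k\<^sup>2) * ((\<iota> k)\<^sup>2 * (f + \<iota> r) - 1) = \<iota> (1 / k\<^sup>2 * k\<^sup>2) * (f + \<iota> r) - \<iota> (1 / k\<^sup>2)"
      by (simp only: scalar_mult scalar_power) (simp add: algebra_simps)
    finally show ?thesis
      using k by (simp add: scalar_one scalar_diff algebra_simps)
  qed
  have descent: "f \<in> M" if "0 \<le> r" "r \<le> real n / k\<^sup>2" "f + \<iota> r \<in> M" for n r
    using that
  proof (induction n arbitrary: r)
    case 0
    then show ?case
      by (simp add: scalar_zero)
  next
    case (Suc n)
    have s: "f + \<iota> (r - 1 / k\<^sup>2) \<in> M"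
      by (rule step) (use Suc.prems in auto)
    show ?case
    \<comment> \<open>If the shift overshoots below zero, the deficit is a nonnegative scalar and is
      added back; otherwise the new shift is still nonnegative, as the induction requires.\<close>
    proof (cases "r \<le> 1 / k\<^sup>2")
      case True
      then have "f + \<iota> (r - 1 / k\<^sup>2) + \<iota> (1 / k\<^sup>2 - r) \<in> M"
        by (intro qmodule_add[OF M s] scalar_mem[OF M]) simp
      then show ?thesis
        by (simp add: scalar_diff)
    next
      case False
      then show ?thesis
        using Suc.prems by (intro Suc.IH[OF _ _ s]) (auto simp: add_divide_distrib)
    qed
  qed
  \<comment> \<open>Starting point of the descent: a bound on \<open>- f\<close> says that
    \<open>f + N\<close> is in \<open>M\<close>.\<close>
  obtain N where N: "0 \<le> N" "\<iota> N - (- f) \<in> M"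
  proof -
    obtain N where "\<iota> N - (- f) \<in> M"
      using arch unfolding archimedean_def by blast
    then have "\<iota> (max 0 N) - (- f) \<in> M"
      by (rule up) simp
    then show ?thesis
      by (intro that[of "max 0 N"]) auto
  qed
  obtain n :: nat where "N * k\<^sup>2 \<le> n"
    using real_arch_simple by blast
  then have "N \<le> n / k\<^sup>2"
    using k by (simp add: field_simps)
  then show ?thesis
    using descent[of N n] N by (simp add: add.commute)
qed

section \<open>Bounded elements\<close>

text \<open>Bounding the square bounds \<open>a\<close> on both sides and matches the form of
  \<open>archimedean_module\<close>.\<close>

definition bounded_in :: "'a set \<Rightarrow> 'a \<Rightarrow> bool" where
  "bounded_in M a \<longleftrightarrow> (\<exists>N. \<iota> N - a\<^sup>2 \<in> M)"

lemma bounded_in_obtain: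
  assumes "qmodule M" "bounded_in M a"
  obtains N where "0 \<le> N" "\<iota> N - a\<^sup>2 \<in> M"
proof -
  obtain N where "\<iota> N - a\<^sup>2 \<in> M"
    using assms(2) by (auto simp: bounded_in_def)
  then have "\<iota> N - a\<^sup>2 + \<iota> (max 0 N - N) \<in> M"
    by (intro qmodule_add scalar_mem assms) simp_all
  then show ?thesis
    using that[of "max 0 N"] by (simp add: scalar_diff)
qed

text \<open>By the parallelogram law,
  \<open>(a + b)^2 + (a - b)^2 = 2 * a^2 + 2 * b^2\<close>.\<close>

lemma bounded_in_add:
  assumes M: "qmodule M" and "bounded_in M a" "bounded_in M b"
  shows "bounded_in M (a + b)"
proof -
  obtain N K where "\<iota> N - a\<^sup>2 \<in> M" "\<iota> K - b\<^sup>2 \<in> M"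
    using assms by (auto simp: bounded_in_def)
  then have "\<iota> 2 * (\<iota> N - a\<^sup>2) + \<iota> 2 * (\<iota> K - b\<^sup>2) + (a - b)\<^sup>2 \<in> M"
    by (intro qmodule_add[OF M] qmodule_square[OF M] scalar_mult_mem[OF M]) auto
  also have "\<iota> 2 * (\<iota> N - a\<^sup>2) + \<iota> 2 * (\<iota> K - b\<^sup>2) + (a - b)\<^sup>2 = \<iota> (2 * N + 2 * K) - (a + b)\<^sup>2"
    using scalar_add[of 1 1]
    by (simp add: scalar_one scalar_add scalar_mult power2_eq_square algebra_simps)
  finally show ?thesis
    by (auto simp: bounded_in_def)
qed

text \<open>\<open>N * K - (a * b)^2 = b^2 * (N - a^2) + N * (K - b^2)\<close>, where the second
  summand needs \<open>N\<close> nonnegative.\<close>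

lemma bounded_in_mult:
  assumes M: "qmodule M" and "bounded_in M a" "bounded_in M b"
  shows "bounded_in M (a * b)"
proof -
  obtain N K where NK: "0 \<le> N" "\<iota> N - a\<^sup>2 \<in> M" "0 \<le> K" "\<iota> K - b\<^sup>2 \<in> M"
    using assms by (meson bounded_in_obtain)
  then have "b\<^sup>2 * (\<iota> N - a\<^sup>2) + \<iota> N * (\<iota> K - b\<^sup>2) \<in> M"
    by (intro qmodule_add[OF M] qmodule_mult_square[OF M] scalar_mult_mem[OF M])
  also have "b\<^sup>2 * (\<iota> N - a\<^sup>2) + \<iota> N * (\<iota> K - b\<^sup>2) = \<iota> (N * K) - (a * b)\<^sup>2"
    by (simp add: scalar_mult power2_eq_square algebra_simps)
  finally show ?thesis
    by (auto simp: bounded_in_def)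
qed

text \<open>Since \<open>(a - 1)^2\<close> is a square, \<open>a\<close> is at most
  \<open>(a^2 + 1) / 2\<close>.\<close>

lemma bounded_in_upper:
  assumes M: "qmodule M" and "bounded_in M a"
  obtains N where "\<iota> N - a \<in> M"
proof -
  obtain N where "\<iota> N - a\<^sup>2 \<in> M"
    using assms by (auto simp: bounded_in_def)
  then have "\<iota> (1/2) * ((a - 1)\<^sup>2 + (\<iota> N - a\<^sup>2)) \<in> M"
    by (intro qmodule_add[OF M] qmodule_square[OF M] scalar_mult_mem[OF M]) auto
  also have "\<iota> (1/2) * ((a - 1)\<^sup>2 + (\<iota> N - a\<^sup>2)) = \<iota> (1/2) * (\<iota> N + 1) - (\<iota> (1/2) + \<iota> (1/2)) * a"
    by (simp only: power2_eq_square) (simp add: algebra_simps)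
  also have "\<dots> = \<iota> (1/2 * (N + 1)) - a"
    by (simp only: scalar_half scalar_mult scalar_add[of N] scalar_one) simp
  finally show ?thesis
    by (rule that)
qed

lemma bounded_in_scalar: "qmodule M \<Longrightarrow> bounded_in M (\<iota> r)"
  unfolding bounded_in_def by (rule exI[of _ "r\<^sup>2"]) (simp add: scalar_power qmodule_zero)

lemma archimedeanI:
  assumes "qmodule M" "\<And>a. bounded_in M a"
  shows "archimedean M"
  unfolding archimedean_def using assms by (meson bounded_in_upper)

text \<open>Algebraic form of "\<open>a\<close> is of lower order than \<open>p\<close>", from below
  only: up to a constant, \<open>a\<close> is at least any small negative multiple of
  \<open>p\<close>.\<close>

definition dominated :: "'a set \<Rightarrow> 'a \<Rightarrow> 'a \<Rightarrow> bool" where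
  "dominated M p a \<longleftrightarrow> (\<forall>e>0. \<exists>C. \<iota> e * p + a + \<iota> C \<in> M)"

lemma dominatedD:
  assumes "dominated M p a" "0 < e"
  obtains C where "\<iota> e * p + a + \<iota> C \<in> M"
  using assms by (auto simp: dominated_def)

lemma dominated_add:
  assumes M: "qmodule M" and "dominated M p a" "dominated M p b"
  shows "dominated M p (a + b)"
  unfolding dominated_def
proof (intro allI impI)
  fix e :: real assume "0 < e"
  then obtain C D where "\<iota> (e/2) * p + a + \<iota> C \<in> M" "\<iota> (e/2) * p + b + \<iota> D \<in> M"
    using assms(2,3) by (meson dominatedD half_gt_zero)
  then have "\<iota> (e/2) * p + a + \<iota> C + (\<iota> (e/2) * p + b + \<iota> D) \<in> M"
    by (rule qmodule_add[OF M])
  also have "\<iota> (e/2) * p + a + \<iota> C + (\<iota> (e/2) * p + b + \<iota> D)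
      = \<iota> (e/2 + e/2) * p + (a + b) + \<iota> (C + D)"
    by (simp only: scalar_add) (simp add: algebra_simps)
  finally show "\<exists>C. \<iota> e * p + (a + b) + \<iota> C \<in> M"
    by auto
qed

lemma dominated_mono:
  assumes M: "qmodule M" and "b - a \<in> M" "dominated M p a"
  shows "dominated M p b"
  unfolding dominated_def
proof (intro allI impI)
  fix e :: real assume "0 < e"
  with assms(3) obtain C where C: "\<iota> e * p + a + \<iota> C \<in> M"
    by (rule dominatedD)
  have "\<iota> e * p + a + \<iota> C + (b - a) \<in> M"
    by (rule qmodule_add[OF M C assms(2)])
  then show "\<exists>C. \<iota> e * p + b + \<iota> C \<in> M"
    by (intro exI[of _ C]) (simp add: algebra_simps)
qed

lemma dominated_nonneg:
  assumes M: "qmodule M" and "p \<in> M" "a \<in> M"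
  shows "dominated M p a"
  unfolding dominated_def
proof (intro allI impI exI)
  fix e :: real assume "0 < e"
  then show "\<iota> e * p + a + \<iota> 0 \<in> M"
    by (intro qmodule_add[OF M] scalar_mult_mem[OF M] scalar_mem[OF M] assms) auto
qed

lemma dominated_sum:
  assumes "qmodule M" "p \<in> M" "\<And>i. i \<in> I \<Longrightarrow> dominated M p (h i)"
  shows "dominated M p (sum h I)"
  using assms(3) by (induction I rule: infinite_finite_induct)
    (auto intro: dominated_add[OF assms(1)] dominated_nonneg assms qmodule_zero)

lemma dominated_scalar:
  assumes M: "qmodule M" and "p \<in> M"
  shows "dominated M p (\<iota> r)"
  unfolding dominated_def
proof (intro allI impI exI)
  fix e :: real assume "0 < e"
  then have "\<iota> e * p \<in> M"
    by (intro scalar_mult_mem[OF M] assms) auto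
  then show "\<iota> e * p + \<iota> r + \<iota> (- r) \<in> M"
    by (simp add: scalar_uminus)
qed

lemma dominated_scale:
  assumes M: "qmodule M" and "0 < r" "dominated M p a"
  shows "dominated M p (\<iota> r * a)"
  unfolding dominated_def
proof (intro allI impI)
  fix e :: real assume "0 < e"
  then obtain C where "\<iota> (e / r) * p + a + \<iota> C \<in> M"
    using assms(2,3) by (meson dominatedD divide_pos_pos)
  then have "\<iota> r * (\<iota> (e / r) * p + a + \<iota> C) \<in> M"
    using assms(2) by (intro scalar_mult_mem[OF M]) auto
  also have "\<iota> r * (\<iota> (e / r) * p + a + \<iota> C) = \<iota> (r * (e / r)) * p + \<iota> r * a + \<iota> (r * C)"
    by (simp only: scalar_mult) (simp add: algebra_simps)
  finally show "\<exists>C. \<iota> e * p + \<iota> r * a + \<iota> C \<in> M"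
    using assms(2) by auto
qed

text \<open>Induction with \<open>e\<close> fixed. Twice the square of
  \<open>d * y^(i+2) - c * y^i\<close> has leading part
  \<open>e * y^(2*i+4) - 2 * y^(2*i+2)\<close>; the induction hypothesis, scaled by
  \<open>2 * c^2\<close>, trades the remaining \<open>y^(2*i)\<close> term for one copy of
  \<open>y^(2*i+2)\<close>.\<close>

lemma dominated_even_power_Suc:
  fixes y :: 'a
  assumes M: "qmodule M"
  shows "dominated M (y ^ (2 * Suc i)) (- (y ^ (2 * i)))"
  unfolding dominated_def
proof (intro allI impI)
  fix e :: real assume e: "0 < e"
  show "\<exists>C. \<iota> e * y ^ (2 * Suc i) + - (y ^ (2 * i)) + \<iota> C \<in> M"
  proof (induction i)
    case 0
    have "\<iota> e * y\<^sup>2 \<in> M"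
      using e by (intro scalar_mult_mem qmodule_square M) simp
    then show ?case
      by (intro exI[of _ 1]) (simp add: scalar_one power2_eq_square)
  next
    case (Suc i)
    then obtain C where C: "\<iota> e * y ^ (2 * Suc i) + - (y ^ (2 * i)) + \<iota> C \<in> M"
      by blast
    \<comment> \<open>The constants satisfy \<open>2 * d^2 = e\<close>, \<open>2 * d * c = 1\<close>
      and \<open>2 * c^2 * e = 1\<close>, one relation for each coefficient to be matched.\<close>
    define d where "d = sqrt (e/2)"
    define c where "c = 1 / (2 * d)"
    define D K P where "D = \<iota> d" "K = \<iota> c" "P = y ^ i"
    have d: "0 < d" "d * d + d * d = e"
      using e by (auto simp: d_def)
    have c: "d * c + d * c = 1" "(c * c + c * c) * e = 1"
      using d(1) unfolding d(2)[symmetric] by (auto simp: c_def field_simps)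
    have rel: "D * D + D * D = \<iota> e" "D * K + D * K = 1" "K * K + K * K = \<iota> (c * c + c * c)"
      by (simp_all only: D_K_P_def c d scalar_one flip: scalar_mult scalar_add)
    have rel4: "(K * K + K * K) * \<iota> e = 1"
      unfolding rel by (simp only: c scalar_one flip: scalar_mult)
    have "(D * (y * y * P) - K * P)\<^sup>2 + (D * (y * y * P) - K * P)\<^sup>2
        + (K * K + K * K) * (\<iota> e * (y * P)\<^sup>2 + - (P\<^sup>2) + \<iota> C)
      = (D * D + D * D) * (y * y * P)\<^sup>2 - (D * K + D * K) * ((y * P)\<^sup>2 + (y * P)\<^sup>2)
        + ((K * K + K * K) * \<iota> e) * (y * P)\<^sup>2 + (K * K + K * K) * \<iota> C"
      by (simp only: power2_eq_square) (simp add: algebra_simps)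
    also have "\<dots> = \<iota> e * (y * y * P)\<^sup>2 + - ((y * P)\<^sup>2) + \<iota> ((c * c + c * c) * C)"
      unfolding rel4 unfolding rel scalar_mult[of _ C] by simp
    finally have eq: "(D * (y * y * P) - K * P)\<^sup>2 + (D * (y * y * P) - K * P)\<^sup>2
        + (K * K + K * K) * (\<iota> e * (y * P)\<^sup>2 + - (P\<^sup>2) + \<iota> C)
      = \<iota> e * (y * y * P)\<^sup>2 + - ((y * P)\<^sup>2) + \<iota> ((c * c + c * c) * C)" .
    have pow: "P\<^sup>2 = y ^ (2 * i)" "(y * P)\<^sup>2 = y ^ (2 * Suc i)" "(y * y * P)\<^sup>2 = y ^ (2 * Suc (Suc i))"
      by (simp_all add: D_K_P_def power_mult_distrib power2_eq_square algebra_simps flip: power_add mult_2)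
    have *: "\<iota> e * (y * P)\<^sup>2 + - (P\<^sup>2) + \<iota> C \<in> M"
      using C by (simp only: pow)
    have "\<iota> e * (y * y * P)\<^sup>2 + - ((y * P)\<^sup>2) + \<iota> ((c * c + c * c) * C) \<in> M"
      unfolding eq[symmetric] rel(3)
      by (rule qmodule_add[OF M qmodule_add[OF M qmodule_square[OF M] qmodule_square[OF M]]
            scalar_mult_mem[OF M _ *]]) simp
    then show ?case
      unfolding pow by blast
  qed
qed

text \<open>Chain of single steps: with \<open>e = 1\<close>, \<open>- (y^(2*i))\<close> is at least
  \<open>- (y^(2*k))\<close> up to a constant, and the latter is dominated by the next even
  power.\<close>

lemma dominated_even_power:
  fixes y :: 'a
  assumes M: "qmodule M" and "i < k"
  shows "dominated M (y ^ (2 * k)) (- (y ^ (2 * i)))"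
  using \<open>i < k\<close>
proof (induction k)
  case (Suc k)
  show ?case
  proof (cases "i = k")
    case True
    then show ?thesis
      using dominated_even_power_Suc[OF M] by simp
  next
    case False
    then have "dominated M (y ^ (2 * k)) (- (y ^ (2 * i)))"
      using Suc by simp
    from this zero_less_one obtain C where "\<iota> 1 * y ^ (2 * k) + - (y ^ (2 * i)) + \<iota> C \<in> M"
      by (rule dominatedD)
    then have *: "- (y ^ (2 * i)) - (- (y ^ (2 * k)) + \<iota> (- C)) \<in> M"
      by (simp add: scalar_one scalar_uminus algebra_simps)
    then show ?thesis
      by (rule dominated_mono[OF M])
        (intro dominated_add[OF M] dominated_even_power_Suc[OF M] dominated_scalar[OF M] even_power_mem[OF M])
  qed
qed simp

lemma bounded_in_uminus: "bounded_in M (- a) \<longleftrightarrow> bounded_in M a"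
  by (simp add: bounded_in_def)

lemma dominated_even_monomial:
  fixes y :: 'a
  assumes M: "qmodule M" and a: "bounded_in M a" and "i < k"
  shows "dominated M (y ^ (2 * k)) (a * y ^ (2 * i))"
proof -
  obtain N where N: "\<iota> N - (- a) \<in> M"
    using bounded_in_upper[OF M, of "- a"] a by (auto simp: bounded_in_uminus)
  \<comment> \<open>The bound is raised to a positive number because \<open>dominated_scale\<close>
    asks for a positive factor.\<close>
  define K where "K = max 1 N"
  have "\<iota> N - (- a) + \<iota> (K - N) \<in> M"
    by (intro qmodule_add[OF M] N scalar_mem[OF M]) (simp add: K_def)
  then have "(y ^ i)\<^sup>2 * (\<iota> N - (- a) + \<iota> (K - N)) \<in> M"
    by (rule qmodule_mult_square[OF M])
  also have "(y ^ i)\<^sup>2 * (\<iota> N - (- a) + \<iota> (K - N)) = a * y ^ (2 * i) - \<iota> K * - (y ^ (2 * i))"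
    by (simp add: scalar_diff algebra_simps flip: power_mult)
  finally show ?thesis
    by (rule dominated_mono[OF M])
      (intro dominated_scale[OF M] dominated_even_power[OF M] \<open>i < k\<close>, simp add: K_def)
qed

text \<open>The square of \<open>y^i * (d * y + c * a)\<close> with \<open>2 * d * c = 1\<close> has
  \<open>a * y^(2*i+1)\<close> as its mixed term. Half of \<open>e\<close> absorbs its
  \<open>y^(2*i+2)\<close> term, the other half the \<open>y^(2*i)\<close> term, once
  \<open>a^2\<close> is replaced by its bound \<open>N\<close>.\<close>

lemma dominated_odd_monomial:
  fixes y :: 'a
  assumes M: "qmodule M" and a: "bounded_in M a" and "i < k"
  shows "dominated M (y ^ (2 * k)) (a * y ^ Suc (2 * i))"
  unfolding dominated_def
proof (intro allI impI)
  fix e :: real assume e: "0 < e"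
  obtain N where N: "\<iota> N - a\<^sup>2 \<in> M" "0 \<le> N"
    using bounded_in_obtain[OF M a] by blast
  define d where "d = sqrt (e/2)"
  define c where "c = 1 / (2 * d)"
  define D K P where "D = \<iota> d" "K = \<iota> c" "P = y ^ i"
  have d: "0 < d" "d * d = e/2"
    using e by (auto simp: d_def)
  have c: "d * c + d * c = 1"
    using d(1) by (auto simp: c_def field_simps)
  have rel: "D * D = \<iota> (e/2)" "D * K + D * K = 1"
    by (simp_all only: D_K_P_def c d scalar_one flip: scalar_mult scalar_add)
  have pow: "P\<^sup>2 = y ^ (2 * i)" "(y * P)\<^sup>2 = y ^ (2 * Suc i)"
    by (simp_all add: D_K_P_def power_mult_distrib power2_eq_square algebra_simps flip: power_add mult_2)
  \<comment> \<open>For \<open>Suc i = k\<close> the difference vanishes; it is separated because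
    \<open>dominated_even_power\<close> compares strictly smaller exponents.\<close>
  obtain C where C: "y ^ (2 * k) - (y * P)\<^sup>2 + \<iota> C \<in> M"
  proof (cases "Suc i = k")
    case True
    then show ?thesis
      using that[of 0] qmodule_zero[OF M] by (simp add: scalar_zero pow)
  next
    case False
    then have "dominated M (y ^ (2 * k)) (- (y ^ (2 * Suc i)))"
      using \<open>i < k\<close> by (intro dominated_even_power[OF M]) simp
    from this zero_less_one obtain C where "\<iota> 1 * y ^ (2 * k) + - (y ^ (2 * Suc i)) + \<iota> C \<in> M"
      by (rule dominatedD)
    then show ?thesis
      using that[of C] by (simp add: scalar_one pow)
  qed
  have "dominated M (y ^ (2 * k)) (- (\<iota> (c * c * N)) * y ^ (2 * i))"
    by (intro dominated_even_monomial[OF M] \<open>i < k\<close>) (auto simp: bounded_in_uminus intro: bounded_in_scalar[OF M])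
  then obtain B where B: "\<iota> (e/2) * y ^ (2 * k) + - (\<iota> (c * c * N)) * y ^ (2 * i) + \<iota> B \<in> M"
    using e by (meson dominatedD half_gt_zero)
  have "P\<^sup>2 * (D * y + K * a)\<^sup>2 + (K * P)\<^sup>2 * (\<iota> N - a\<^sup>2) + \<iota> (e/2) * (y ^ (2 * k) - (y * P)\<^sup>2 + \<iota> C)
      + (\<iota> (e/2) * y ^ (2 * k) + - (\<iota> (c * c * N)) * y ^ (2 * i) + \<iota> B) \<in> M"
    using e by (intro qmodule_add[OF M] qmodule_mult_square[OF M] qmodule_square[OF M] scalar_mult_mem[OF M] N C B) simp
  also have "P\<^sup>2 * (D * y + K * a)\<^sup>2 + (K * P)\<^sup>2 * (\<iota> N - a\<^sup>2) + \<iota> (e/2) * (y ^ (2 * k) - (y * P)\<^sup>2 + \<iota> C)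
      + (\<iota> (e/2) * y ^ (2 * k) + - (\<iota> (c * c * N)) * y ^ (2 * i) + \<iota> B)
    = (D * D) * (y * P)\<^sup>2 - \<iota> (e/2) * (y * P)\<^sup>2 + (D * K + D * K) * (a * (y * P\<^sup>2))
      + (\<iota> (e/2) + \<iota> (e/2)) * y ^ (2 * k) + (\<iota> (e/2) * \<iota> C + \<iota> B)"
    unfolding pow(1)[symmetric] scalar_mult D_K_P_def(2)[symmetric]
    by (simp only: power2_eq_square) (simp add: algebra_simps)
  also have "\<dots> = \<iota> (e/2 + e/2) * y ^ (2 * k) + a * (y * P\<^sup>2) + \<iota> (e/2 * C + B)"
    unfolding rel scalar_add scalar_mult by simp
  finally have "\<iota> e * y ^ (2 * k) + a * y ^ Suc (2 * i) + \<iota> (e/2 * C + B) \<in> M"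
    by (simp add: pow)
  then show "\<exists>C. \<iota> e * y ^ (2 * k) + a * y ^ Suc (2 * i) + \<iota> C \<in> M" ..
qed

lemma dominated_monomial:
  fixes y :: 'a
  assumes "qmodule M" "bounded_in M a" "j < 2 * k"
  shows "dominated M (y ^ (2 * k)) (a * y ^ j)"
proof (cases "even j")
  case True
  then show ?thesis
    using assms dominated_even_monomial by (auto elim!: evenE)
next
  case False
  then show ?thesis
    using assms dominated_odd_monomial by (auto elim!: oddE)
qed

text \<open>Multiplied by \<open>y ^ (n + 4)\<close>, the monic relation equates an even power of
  \<open>y\<close> with a sum of lower terms, modulo the support of \<open>M\<close>. The same even
  power dominates those terms together with \<open>- (y^2)\<close>, so cancelling it leaves
  \<open>C - y^2\<close> in \<open>M\<close>.\<close>

theorem bounded_in_integral: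
  fixes y :: 'a
  assumes M: "qmodule M" and b: "\<And>j. j < n \<Longrightarrow> bounded_in M (b j)"
    and root: "y ^ n + (\<Sum>j<n. b j * y ^ j) \<in> M" "- (y ^ n + (\<Sum>j<n. b j * y ^ j)) \<in> M"
  shows "bounded_in M y"
proof -
  let ?z = "y ^ n + (\<Sum>j<n. b j * y ^ j)"
  \<comment> \<open>The factor \<open>y ^ (n + 4)\<close> makes the degree even and larger than \<open>2\<close>.\<close>
  define k where "k = n + 2"
  have "(- 1) * y\<^sup>2 + (\<Sum>j<n. b j * y ^ (j + n + 4)) = - y\<^sup>2 + y ^ (n + 4) * (\<Sum>j<n. b j * y ^ j)"
    by (simp add: sum_distrib_left power_add algebra_simps)
  moreover have "dominated M (y ^ (2 * k)) ((- 1) * y\<^sup>2 + (\<Sum>j<n. b j * y ^ (j + n + 4)))"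
    by (intro dominated_add[OF M] dominated_sum[OF M] dominated_monomial[OF M] b even_power_mem[OF M])
      (auto simp: k_def bounded_in_uminus intro: bounded_in_scalar[OF M, of 1, unfolded scalar_one])
  ultimately have "dominated M (y ^ (2 * k)) (- y\<^sup>2 + y ^ (n + 4) * (\<Sum>j<n. b j * y ^ j))"
    by simp
  from this zero_less_one obtain C where
    "\<iota> 1 * y ^ (2 * k) + (- y\<^sup>2 + y ^ (n + 4) * (\<Sum>j<n. b j * y ^ j)) + \<iota> C \<in> M"
    by (rule dominatedD)
  moreover have "y ^ (n + 4) * - ?z \<in> M"
    by (rule support_ideal[OF M root(2)]) (simp only: minus_minus root(1))
  ultimately have "\<iota> 1 * y ^ (2 * k) + (- y\<^sup>2 + y ^ (n + 4) * (\<Sum>j<n. b j * y ^ j)) + \<iota> C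
      + y ^ (n + 4) * - ?z \<in> M"
    by (rule qmodule_add[OF M])
  also have "2 * k = (n + 4) + n"
    by (simp add: k_def)
  also have "y ^ \<dots> = y ^ (n + 4) * y ^ n"
    by (rule power_add)
  finally show ?thesis
    unfolding bounded_in_def by (intro exI[of _ C]) (simp add: scalar_one algebra_simps)
qed

end

section \<open>Adjugates and the Cayley-Hamilton theorem\<close>

text \<open>The entries of \<open>B\<close> are cofactors: row \<open>i\<close> of \<open>A\<close>
  is replaced by a unit vector. Linearity in that row assembles the product entry into a determinant
  with row \<open>j\<close> in place of row \<open>i\<close>, which has a repeated row unless
  \<open>i = j\<close>.\<close>

lemma right_adjugate_exists:
  fixes A :: "'a::comm_ring_1 ^ 'n::finite ^ 'n"
  shows "\<exists>B. A ** B = mat (det A)"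
proof -
  define B where "B = (\<chi> k i. det (\<chi> l. if l = i then axis k 1 else A $ l))"
  have "(A ** B) $ j $ i = mat (det A) $ j $ i" for i j
  proof -
    have "(A ** B) $ j $ i = (\<Sum>k\<in>UNIV. A $ j $ k * det (\<chi> l. if l = i then axis k 1 else A $ l))"
      by (simp add: matrix_matrix_mult_def B_def)
    also have "\<dots> = (\<Sum>k\<in>UNIV. det (\<chi> l. if l = i then A $ j $ k *s axis k 1 else A $ l))"
      using det_row_mul[of i _ "\<lambda>_. axis _ 1" "\<lambda>l. A $ l"] by simp
    also have "\<dots> = det (\<chi> l. if l = i then (\<Sum>k\<in>UNIV. A $ j $ k *s axis k 1) else A $ l)"
      by (rule det_linear_row_sum[symmetric]) simp
    also have "(\<Sum>k\<in>UNIV. A $ j $ k *s axis k 1) = A $ j"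
      by (simp add: vec_eq_iff axis_def if_distrib cong: if_cong)
    also have "det (\<chi> l. if l = i then A $ j else A $ l) = mat (det A) $ j $ i"
    proof (cases "i = j")
      case True
      then have "(\<chi> l. if l = i then A $ j else A $ l) = A"
        by (simp add: vec_eq_iff)
      then show ?thesis
        using True by (simp add: mat_def)
    next
      case False
      then have "det (\<chi> l. if l = i then A $ j else A $ l) = 0"
        by (intro det_identical_rows[of i j]) (auto simp: row_def)
      then show ?thesis
        using False by (simp add: mat_def)
    qed
    finally show ?thesis .
  qed
  then have "A ** B = mat (det A)"
    by (simp add: vec_eq_iff)
  then show ?thesis ..
qed

lemma left_adjugate_exists:
  fixes A :: "'a::comm_ring_1 ^ 'n::finite ^ 'n"
  shows "\<exists>B. B ** A = mat (det A)"
proof -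
  obtain B where "transpose A ** B = mat (det (transpose A))"
    using right_adjugate_exists by blast
  then have "transpose B ** A = transpose (mat (det A))"
    by (metis det_transpose matrix_transpose_mul transpose_transpose)
  also have "\<dots> = mat (det A)"
    by (simp add: vec_eq_iff transpose_def mat_def)
  finally show ?thesis ..
qed

section \<open>Substituting a matrix into a polynomial\<close>

lemma matrix_add_rdistrib: "(A + B) ** C = A ** C + B ** (C :: 'a::semiring_1 ^ _ ^ _)"
  by (simp add: vec_eq_iff matrix_matrix_mult_def distrib_right sum.distrib)

lemma matrix_mult_row: "(A ** B) $ i = A $ i v* (B :: 'a::semiring_1 ^ _ ^ _)"
  by (simp add: vec_eq_iff matrix_matrix_mult_def vector_matrix_mult_def)

lemma vector_matrix_mult_sum: "sum h I v* B = (\<Sum>i\<in>I. h i v* (B :: 'a::semiring_1 ^ _ ^ _))"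
  by (induction I rule: infinite_finite_induct)
    (auto simp: vec_eq_iff vector_matrix_mult_def distrib_right sum.distrib)

lemma mat_mult_nth: "(mat a ** B) $ i $ j = a * B $ i $ (j :: 'n::finite)"
  for B :: "'a::semiring_1 ^ 'n ^ 'm::finite"
  by (simp add: matrix_matrix_mult_def mat_def if_distrib if_distribR cong: if_cong)

lemma mult_mat_nth: "(B ** mat a) $ i $ j = B $ i $ j * a"
  for B :: "'a::semiring_1 ^ 'n::finite ^ 'm::finite"
  by (simp add: matrix_matrix_mult_def mat_def if_distrib if_distribR cong: if_cong)

lemma mat_mult_commute: "mat a ** B = B ** mat a"
  for B :: "'a::comm_semiring_1 ^ 'n::finite ^ 'n"
  by (simp add: vec_eq_iff mat_mult_nth mult_mat_nth mult.commute)

lemma mat_add: "mat (a + b) = mat a + (mat b :: 'a::monoid_add ^ 'n ^ 'n::finite)"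
  by (simp add: vec_eq_iff mat_def)

lemma mat_mult: "mat (a * b) = mat a ** (mat b :: 'a::semiring_1 ^ 'n ^ 'n::finite)"
  by (simp add: vec_eq_iff mat_mult_nth) (simp add: mat_def)

text \<open>Horner evaluation with the matrix product \<open>**\<close> and coefficients read as
  scalar matrices.\<close>

definition matrix_poly :: "'a::comm_ring_1 ^ 'n ^ 'n::finite \<Rightarrow> 'a poly \<Rightarrow> 'a ^ 'n ^ 'n" where
  "matrix_poly A p = fold_coeffs (\<lambda>a B. mat a + A ** B) p 0"

lemma matrix_poly_0 [simp]: "matrix_poly A 0 = 0"
  by (simp add: matrix_poly_def)

lemma matrix_poly_pCons [simp]: "matrix_poly A (pCons a p) = mat a + A ** matrix_poly A p"
  by (cases "a = 0 \<and> p = 0") (auto simp: matrix_poly_def)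

lemma matrix_poly_add: "matrix_poly A (p + q) = matrix_poly A p + matrix_poly A q"
proof (induction p arbitrary: q)
  case (pCons a p)
  then show ?case
    by (cases q) (simp add: mat_add matrix_add_ldistrib)
qed simp

lemma matrix_poly_uminus: "matrix_poly A (- p) = - matrix_poly A p"
  using matrix_poly_add[of A p "- p"] by (simp add: eq_neg_iff_add_eq_0 add.commute)

lemma matrix_poly_sum: "matrix_poly A (sum h I) = (\<Sum>i\<in>I. matrix_poly A (h i))"
  by (induction I rule: infinite_finite_induct) (auto simp: matrix_poly_add)

lemma matrix_poly_smult: "matrix_poly A (smult a p) = mat a ** matrix_poly A p"
proof (induction p)
  case (pCons c p)
  have "A ** (mat a ** X) = mat a ** (A ** X)" for X
    by (metis mat_mult_commute matrix_mul_assoc)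
  with pCons show ?case
    by (simp add: mat_mult matrix_add_ldistrib)
qed simp

lemma matrix_poly_mult: "matrix_poly A (p * q) = matrix_poly A p ** matrix_poly A q"
  by (induction p) (auto simp: matrix_poly_add matrix_poly_smult matrix_add_rdistrib matrix_mul_assoc)

text \<open>The matrix \<open>Y - A\<close> over the polynomial ring in \<open>Y\<close>; its
  determinant is the monic characteristic polynomial.\<close>

definition char_matrix :: "'a::comm_ring_1 ^ 'n ^ 'n::finite \<Rightarrow> 'a poly ^ 'n ^ 'n" where
  "char_matrix A = (\<chi> i j. [:- A $ i $ j, if i = j then 1 else 0:])"

text \<open>Determinant trick. The entries of \<open>?T\<close>, evaluated at \<open>A\<close> and
  applied to the unit row vectors, sum to zero along each row of \<open>?T\<close>. A left adjugate
  turns this system into the diagonal one, in which \<open>det ?T\<close> evaluated at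
  \<open>A\<close> annihilates every unit row vector.\<close>

theorem cayley_hamilton: "matrix_poly A (det (char_matrix A)) = 0"
proof -
  let ?T = "char_matrix A"
  obtain B where B: "B ** ?T = mat (det ?T)"
    using left_adjugate_exists by blast
  have rows: "(\<Sum>i\<in>UNIV. matrix_poly A (?T $ k $ i) $ i) = 0" for k
  proof -
    have "matrix_poly A (?T $ k $ i) $ i $ j = (if k = i then A $ k $ j else 0) - (if i = j then A $ k $ j else 0)" for i j
      by (simp add: char_matrix_def mult_mat_nth) (auto simp: mat_def)
    then show ?thesis
      by (simp add: vec_eq_iff sum_subtractf)
  qed
  have "matrix_poly A (det ?T) $ j = 0" for j
  proof -
    have "matrix_poly A (det ?T) $ j = (\<Sum>i\<in>UNIV. matrix_poly A ((B ** ?T) $ j $ i) $ i)"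
      unfolding B by (simp add: mat_def if_distrib if_distribR cong: if_cong)
    also have "\<dots> = (\<Sum>i\<in>UNIV. \<Sum>k\<in>UNIV. (matrix_poly A (?T $ k $ i) ** matrix_poly A (B $ j $ k)) $ i)"
    proof -
      \<comment> \<open>The factors are swapped so that the entry of \<open>?T\<close> acts first on
        row vectors, which are multiplied from the right.\<close>
      have "(B ** ?T) $ j $ i = (\<Sum>k\<in>UNIV. ?T $ k $ i * B $ j $ k)" for i
        by (simp add: matrix_matrix_mult_def mult.commute)
      then show ?thesis
        by (simp only: matrix_poly_sum matrix_poly_mult sum_component)
    qed
    also have "\<dots> = (\<Sum>k\<in>UNIV. (\<Sum>i\<in>UNIV. matrix_poly A (?T $ k $ i) $ i) v* matrix_poly A (B $ j $ k))"
      by (subst sum.swap) (simp add: matrix_mult_row vector_matrix_mult_sum)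
    also have "\<dots> = 0"
      by (simp add: rows)
    finally show ?thesis .
  qed
  then show ?thesis
    by (simp add: vec_eq_iff)
qed

text \<open>The coefficient is taken at \<open>card S\<close>, not at the degree, because factors
  with \<open>b i = 0\<close> lower the degree.\<close>

lemma prod_linear_factors:
  assumes "finite S"
  shows "degree (\<Prod>i\<in>S. [:a i, b i:]) \<le> card S \<and> coeff (\<Prod>i\<in>S. [:a i, b i:]) (card S) = prod b S"
  using assms
proof (induction rule: finite_induct)
  case (insert x S)
  let ?P = "\<Prod>i\<in>S. [:a i, b i:]"
  have IH: "degree ?P \<le> card S" "coeff ?P (card S) = prod b S"
    using insert.IH by auto
  have "degree ([:a x, b x:] * ?P) \<le> degree [:a x, b x:] + degree ?P"
    by (rule degree_mult_le)
  also have "\<dots> \<le> 1 + card S"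
    using IH(1) by (intro add_mono) auto
  finally have "degree ([:a x, b x:] * ?P) \<le> Suc (card S)"
    by simp
  moreover have "coeff ?P (Suc (card S)) = 0"
    using IH(1) by (intro coeff_eq_0) simp
  then have "coeff ([:a x, b x:] * ?P) (Suc (card S)) = b x * prod b S"
    by (simp add: IH(2))
  ultimately show ?case
    using insert.hyps by simp
qed simp

text \<open>In the Leibniz expansion every product has at most \<open>CARD('n)\<close> linear
  factors, and only the identity permutation selects the variable in all of them.\<close>

lemma
  fixes A :: "'a::comm_ring_1 ^ 'n ^ 'n::finite"
  shows degree_char_poly: "degree (det (char_matrix A)) \<le> CARD('n)"
    and monic_char_poly: "coeff (det (char_matrix A)) CARD('n) = 1"
proof -
  let ?P = "\<lambda>p. \<Prod>i\<in>UNIV. char_matrix A $ i $ p i"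
  have deg: "degree (?P p) \<le> CARD('n)" for p
    using prod_linear_factors[of UNIV "\<lambda>i. - A $ i $ p i" "\<lambda>i. if i = p i then 1 else 0"]
    by (simp add: char_matrix_def)
  have coeff: "coeff (?P p) CARD('n) = (if p = id then 1 else 0)" for p
  proof -
    have "coeff (?P p) CARD('n) = (\<Prod>i\<in>UNIV. if i = p i then 1 else 0)"
      using prod_linear_factors[of UNIV "\<lambda>i. - A $ i $ p i" "\<lambda>i. if i = p i then 1 else 0"]
      by (simp add: char_matrix_def)
    also have "\<dots> = (if p = id then 1 else 0)"
    proof (cases "p = id")
      case False
      then obtain i where "p i \<noteq> i"
        by (auto simp: fun_eq_iff)
      then have "(\<Prod>i\<in>UNIV. if i = p i then 1 else 0 :: 'a) = 0"
        by (intro prod_zero bexI[of _ i]) auto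
      then show ?thesis
        using False by simp
    qed simp
    finally show ?thesis .
  qed
  have sgn: "of_int (sign p) = (1 :: 'a poly) \<or> of_int (sign p) = (- 1 :: 'a poly)" for p :: "'n \<Rightarrow> 'n"
    by (auto simp: sign_def)
  have "degree (of_int (sign p) * ?P p) \<le> CARD('n)" for p
    using sgn[of p] deg[of p] by auto
  then show "degree (det (char_matrix A)) \<le> CARD('n)"
    unfolding det_def by (intro degree_sum_le) (auto simp: finite_permutations)
  have "coeff (of_int (sign p) * ?P p) CARD('n) = (if p = id then 1 else 0)" for p
    using sgn[of p] coeff[of p] by auto
  then show "coeff (det (char_matrix A)) CARD('n) = 1"
    unfolding det_def by (simp add: coeff_sum finite_permutations permutes_id)
qed

section \<open>Evaluation of polynomials\<close>

text \<open>Writes a polynomial in terms of constants and variables alone, so that a homomorphism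
  can be computed from its values on the variables.\<close>

lemma mpoly_expand:
  fixes p :: "'n::finite real_mpoly"
  shows "p = (\<Sum>m\<in>Poly_Mapping.keys p. Poly_Mapping.single 0 (Poly_Mapping.lookup p m) *
    (\<Prod>i\<in>UNIV. Poly_Mapping.single (Poly_Mapping.single i 1) 1 ^ Poly_Mapping.lookup m i))"
proof -
  have var_power: "Poly_Mapping.single (Poly_Mapping.single i 1) 1 ^ k = Poly_Mapping.single (Poly_Mapping.single i k) (1::real)"
    for i :: 'n and k
    by (induction k) (auto simp: mult_single simp flip: single_add)
  have single_sum: "Poly_Mapping.single (sum h I) (1::real) = (\<Prod>i\<in>I. Poly_Mapping.single (h i) 1)"
    for h :: "'n \<Rightarrow> 'n \<Rightarrow>\<^sub>0 nat" and I
  proof -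
    have "Poly_Mapping.single (a + b) (1::real) = Poly_Mapping.single a 1 * Poly_Mapping.single b 1" for a b :: "'n \<Rightarrow>\<^sub>0 nat"
      by (simp add: mult_single)
    then show ?thesis
      by (induction I rule: infinite_finite_induct) auto
  qed
  have monomial: "(\<Prod>i\<in>UNIV. Poly_Mapping.single (Poly_Mapping.single i 1) 1 ^ Poly_Mapping.lookup m i)
      = Poly_Mapping.single m (1::real)" for m :: "'n \<Rightarrow>\<^sub>0 nat"
  proof -
    have m: "(\<Sum>i\<in>UNIV. Poly_Mapping.single i (Poly_Mapping.lookup m i)) = m"
      by (rule poly_mapping_eqI) (simp add: lookup_sum lookup_single when_def)
    show ?thesis
      unfolding var_power single_sum[symmetric] m ..
  qed
  show ?thesis
    unfolding monomial mult_single
    by (rule poly_mapping_eqI) (simp add: lookup_sum lookup_single when_def in_keys_iff)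
qed

text \<open>Reals are embedded as constants in \<open>X\<close> and then as constants in the outer
  variable, which stands for \<open>f\<close>.\<close>

interpretation mpoly_scalars: real_scalars "\<lambda>r. [:Poly_Mapping.single 0 r :: 'n::finite real_mpoly:]"
  by standard (auto simp: single_add mult_single one_pCons mult.commute)

lemma const_poly_sum: "[:sum h I:] = (\<Sum>i\<in>I. [:h i:])"
proof (induction I rule: infinite_finite_induct)
  case (insert x F)
  have "[:h x + sum h F:] = [:h x:] + [:sum h F:]"
    by simp
  with insert show ?case
    by (simp only: sum.insert not_False_eq_True)
qed auto

lemma const_poly_mult: "[:a * b:] = [:a:] * [:b:]"
  for a :: "'a::comm_ring_1"
  by simp

lemma const_poly_power: "[:a ^ n:] = [:a:] ^ n"
  for a :: "'a::comm_ring_1"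
  by (induction n) (simp_all only: power_0 power_Suc const_poly_mult one_pCons)

section \<open>Real homomorphisms as points and eigenvalues\<close>

context
  fixes \<alpha> :: "'n::finite real_mpoly poly \<Rightarrow> real"
  assumes hom: "mpoly_scalars.real_hom \<alpha>"
begin

lemma hom_add: "\<alpha> (p + q) = \<alpha> p + \<alpha> q"
  and hom_mult: "\<alpha> (p * q) = \<alpha> p * \<alpha> q"
  and hom_scalar: "\<alpha> [:Poly_Mapping.single 0 r:] = r"
  using hom by (auto simp: mpoly_scalars.real_hom_def)

lemma hom_0: "\<alpha> 0 = 0"
  using hom_scalar[of 0] by simp

lemma hom_1: "\<alpha> 1 = 1"
  using hom_scalar[of 1] by (simp add: one_pCons)

lemma hom_uminus: "\<alpha> (- p) = - \<alpha> p"
  using hom_add[of p "- p"] by (simp add: hom_0)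

lemma hom_sum: "\<alpha> (sum h I) = (\<Sum>i\<in>I. \<alpha> (h i))"
  by (induction I rule: infinite_finite_induct) (auto simp: hom_0 hom_add)

lemma hom_prod: "\<alpha> (prod h I) = (\<Prod>i\<in>I. \<alpha> (h i))"
  by (induction I rule: infinite_finite_induct) (auto simp: hom_1 hom_mult)

lemma hom_power: "\<alpha> (p ^ n) = \<alpha> p ^ n"
  by (induction n) (auto simp: hom_1 hom_mult)

lemma hom_det:
  fixes A :: "'n real_mpoly poly ^ 't ^ 't::finite"
  shows "\<alpha> (det A) = det (map_matrix \<alpha> A)"
proof -
  have "\<alpha> (of_int (sign p)) = of_int (sign p)" for p :: "'t \<Rightarrow> 't"
    by (simp add: sign_def hom_1 hom_uminus)
  then show ?thesis
    by (simp add: det_def hom_sum hom_mult hom_prod)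
qed

definition hom_point :: "real ^ 'n" where
  "hom_point = (\<chi> i. \<alpha> [:Poly_Mapping.single (Poly_Mapping.single i 1) 1:])"

lemma hom_const: "\<alpha> [:p:] = mpoly_eval p hom_point"
proof -
  define h where "h q = \<alpha> [:q:]" for q
  have h_mult: "h (q * r) = h q * h r" for q r
    by (simp only: h_def const_poly_mult hom_mult)
  have h_1: "h 1 = 1"
    using hom_1 by (simp add: h_def one_pCons)
  have h_sum: "h (sum k I) = (\<Sum>i\<in>I. h (k i))" for k :: "('n \<Rightarrow>\<^sub>0 nat) \<Rightarrow> _" and I
    by (simp add: h_def const_poly_sum hom_sum)
  have h_prod: "h (prod k I) = (\<Prod>i\<in>I. h (k i))" for k :: "'n \<Rightarrow> _" and I
    by (induction I rule: infinite_finite_induct) (auto simp: h_1 h_mult)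
  have h_power: "h (q ^ n) = h q ^ n" for q n
    by (simp add: h_def const_poly_power hom_power)
  have "h p = (\<Sum>m\<in>Poly_Mapping.keys p. Poly_Mapping.lookup p m *
      (\<Prod>i\<in>UNIV. hom_point $ i ^ Poly_Mapping.lookup m i))"
    by (subst mpoly_expand) (simp add: h_sum h_mult h_prod h_power, simp add: h_def hom_scalar hom_point_def)
  then show ?thesis
    by (simp add: h_def mpoly_eval_def)
qed

text \<open>Applying \<open>\<alpha>\<close> entrywise to \<open>char_matrix f\<close> gives
  \<open>c - f(x)\<close> at the point \<open>x = hom_point\<close>. Its determinant vanishes, and a
  kernel vector is an eigenvector.\<close>

lemma hom_eigenvalue:
  fixes f :: "('n, 't::finite) real_mpoly_matrix"
  assumes "\<alpha> (det (char_matrix f)) = 0"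
  shows "real_eigenvalue (mpoly_matrix_eval f hom_point) (\<alpha> [:0, 1:])"
proof -
  let ?F = "mpoly_matrix_eval f hom_point"
  define c where "c = \<alpha> [:0, 1:]"
  have lin: "\<alpha> [:a, b:] = mpoly_eval a hom_point + c * mpoly_eval b hom_point" for a b
    unfolding c_def hom_const[symmetric] hom_add[symmetric] hom_mult[symmetric] by simp
  have eval_uminus: "mpoly_eval (- p) hom_point = - mpoly_eval p hom_point" for p
    unfolding hom_const[symmetric] hom_uminus[symmetric] by simp
  have eval_0: "mpoly_eval 0 hom_point = 0" and eval_1: "mpoly_eval 1 hom_point = 1"
    unfolding hom_const[symmetric] by (simp_all add: hom_0 hom_1 flip: one_pCons)
  have "map_matrix \<alpha> (char_matrix f) = mat c - ?F"
    by (simp add: vec_eq_iff char_matrix_def lin eval_uminus eval_0 eval_1 mat_def mpoly_matrix_eval_def)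
  then have "det (mat c - ?F) = 0"
    using assms by (simp add: hom_det)
  then have "\<not> invertible (mat c - ?F)"
    by (simp add: invertible_det_nz)
  then obtain v where v: "v \<noteq> 0" "(mat c - ?F) *v v = 0"
    using invertible_left_inverse matrix_left_invertible_ker by blast
  have "mat c *v v = c *s v"
    by (simp add: vec_eq_iff matrix_vector_mult_def mat_def if_distrib if_distribR cong: if_cong)
  then have "?F *v v = c *s v"
    using v(2) by (simp add: matrix_vector_mult_diff_rdistrib)
  then show ?thesis
    using v(1) by (auto simp: real_eigenvalue_def c_def)
qed

end

section \<open>The quadratic module of the matrix algebra\<close>

lemma matrix_poly_mem_adjoin: "matrix_poly f p \<in> adjoin f"
proof (induction p)
  case 0
  show ?case
    using adjoin.scalar[of 0 f] by simp
qed (auto intro: adjoin.intros)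

lemma quadratic_module_adjoin_add:
  assumes "a \<in> quadratic_module_adjoin f G" "b \<in> quadratic_module_adjoin f G"
  shows "a + b \<in> quadratic_module_adjoin f G"
proof -
  obtain N h g where a: "a = (\<Sum>i=1..N. (h i ** h i) ** mat (g i))" "1 \<le> (N::nat)"
      "\<forall>i\<in>{1..N}. h i \<in> adjoin f \<and> g i \<in> insert 1 G"
    using assms(1) unfolding quadratic_module_adjoin_def by blast
  obtain K h' g' where b: "b = (\<Sum>i=1..K. (h' i ** h' i) ** mat (g' i))" "1 \<le> (K::nat)"
      "\<forall>i\<in>{1..K}. h' i \<in> adjoin f \<and> g' i \<in> insert 1 G"
    using assms(2) unfolding quadratic_module_adjoin_def by blast
  \<comment> \<open>The two families are concatenated, the second shifted by
    \<open>N\<close>.\<close>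
  define H where "H i = (if i \<le> N then h i else h' (i - N))" for i
  define R where "R i = (if i \<le> N then g i else g' (i - N))" for i
  have split: "{1..N + K} = {1..N} \<union> {1 + N..K + N}"
    by auto
  have "(\<Sum>i=1..N + K. (H i ** H i) ** mat (R i))
      = (\<Sum>i=1..N. (H i ** H i) ** mat (R i)) + (\<Sum>i=1 + N..K + N. (H i ** H i) ** mat (R i))"
    unfolding split by (rule sum.union_disjoint) auto
  also have "(\<Sum>i=1 + N..K + N. (H i ** H i) ** mat (R i)) = (\<Sum>i=1..K. (H (i + N) ** H (i + N)) ** mat (R (i + N)))"
    by (rule sum.shift_bounds_cl_nat_ivl)
  also have "\<dots> = b"
    unfolding b(1) by (intro sum.cong) (auto simp: H_def R_def)
  also have "(\<Sum>i=1..N. (H i ** H i) ** mat (R i)) = a"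
    unfolding a(1) by (intro sum.cong) (auto simp: H_def R_def)
  finally have "a + b = (\<Sum>i=1..N + K. (H i ** H i) ** mat (R i))"
    by simp
  moreover have "H i \<in> adjoin f \<and> R i \<in> insert 1 G" if "i \<in> {1..N + K}" for i
  proof (cases "i \<le> N")
    case True
    then show ?thesis
      using a(3) that by (simp add: H_def R_def)
  next
    case False
    then have "i - N \<in> {1..K}"
      using that by auto
    then show ?thesis
      using b(3) False by (auto simp: H_def R_def)
  qed
  moreover have "1 \<le> N + K"
    using a(2) by simp
  ultimately show ?thesis
    unfolding quadratic_module_adjoin_def by blast
qed

lemma quadratic_module_adjoin_base:
  assumes "h \<in> adjoin f" "g \<in> insert 1 G"
  shows "(h ** h) ** mat g \<in> quadratic_module_adjoin f G"
  unfolding quadratic_module_adjoin_def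
  using assms by (auto intro!: exI[of _ "1::nat"] exI[of _ "\<lambda>_. h"] exI[of _ "\<lambda>_. g"])

lemma matrix_poly_qgen:
  assumes "p \<in> qgen ((\<lambda>g. [:g:]) ` G)"
  shows "matrix_poly f p \<in> quadratic_module_adjoin f G"
  using assms
proof (induction rule: qgen.induct)
  \<comment> \<open>Sums in \<open>quadratic_module_adjoin\<close> have at least one term, so zero
    is represented as the square of zero times \<open>1\<close>.\<close>
  case zero
  show ?case
    using quadratic_module_adjoin_base[OF adjoin.scalar[of 0], of 1 G f] by simp
next
  case (base b p)
  then obtain g where g: "g \<in> insert 1 G" "b = [:g:]"
    by (auto simp: one_pCons)
  have "matrix_poly f (p\<^sup>2 * [:g:]) = (matrix_poly f p ** matrix_poly f p) ** mat g"
    unfolding matrix_poly_mult power2_eq_square by simp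
  then show ?case
    using quadratic_module_adjoin_base[OF matrix_poly_mem_adjoin g(1)] by (simp only: g(2))
next
  case (add a b)
  then show ?case
    by (simp add: matrix_poly_add quadratic_module_adjoin_add)
qed

lemma const_poly_quadratic_module:
  assumes "q \<in> quadratic_module G"
  shows "[:q:] \<in> qgen ((\<lambda>g. [:g:]) ` G)"
proof -
  obtain N :: nat and p g where q: "q = (\<Sum>i=1..N. (p i)\<^sup>2 * g i)" "\<forall>i\<in>{1..N}. g i \<in> insert 1 G"
    using assms unfolding quadratic_module_def by blast
  have "[:q:] = (\<Sum>i=1..N. [:p i:]\<^sup>2 * [:g i:])"
    by (simp only: q(1) const_poly_sum const_poly_mult const_poly_power)
  also have "\<dots> \<in> qgen ((\<lambda>g. [:g:]) ` G)"
    using q(2) by (intro qmodule_sum[OF qmodule_qgen] qgen.base) (auto simp: one_pCons)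
  finally show ?thesis .
qed

theorem theorem20:
  fixes G :: "'n::finite real_mpoly set"
    and f :: "('n, 't::finite) real_mpoly_matrix"
  assumes "archimedean_module (quadratic_module G)"
    and "\<forall>x \<in> nonneg_set G. \<forall>c. real_eigenvalue (mpoly_matrix_eval f x) c \<longrightarrow> 0 < c"
  shows "f \<in> quadratic_module_adjoin f G"
proof -
  let ?B = "(\<lambda>g. [:g:]) ` G" and ?Y = "[:0, 1:] :: 'n real_mpoly poly"
  let ?\<chi> = "det (char_matrix f)"
  \<comment> \<open>Defined through equality after substitution, \<open>M\<close> inherits closure
    from \<open>qgen ?B\<close> and contains the whole kernel of the substitution.\<close>
  define M where "M = {p. \<exists>q\<in>qgen ?B. matrix_poly f p = matrix_poly f q}"
  have qgen_M: "qgen ?B \<subseteq> M"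
    by (auto simp: M_def)
  have M: "qmodule M"
    unfolding qmodule_def
  proof (intro conjI ballI allI)
    show "1 \<in> M"
      using qgen_M qgen_generator by blast
  next
    fix a b assume "a \<in> M" "b \<in> M"
    then obtain p q where "p \<in> qgen ?B" "q \<in> qgen ?B" "matrix_poly f a = matrix_poly f p" "matrix_poly f b = matrix_poly f q"
      by (auto simp: M_def)
    then show "a + b \<in> M"
      unfolding M_def by (intro CollectI bexI[of _ "p + q"]) (simp_all add: matrix_poly_add qgen.add)
  next
    fix a b assume "b \<in> M"
    then obtain q where "q \<in> qgen ?B" "matrix_poly f b = matrix_poly f q"
      by (auto simp: M_def)
    then show "a\<^sup>2 * b \<in> M"
      unfolding M_def by (intro CollectI bexI[of _ "a\<^sup>2 * q"])
        (simp_all add: matrix_poly_mult qmodule_mult_square[OF qmodule_qgen])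
  qed
  have kernel: "p \<in> M" if "matrix_poly f p = 0" for p
    unfolding M_def using that by (intro CollectI bexI[of _ 0]) (simp_all add: qgen.zero)
  have \<chi>: "?\<chi> \<in> M" "- ?\<chi> \<in> M"
    by (auto intro!: kernel simp: cayley_hamilton matrix_poly_uminus)
  have const_bounded: "mpoly_scalars.bounded_in M [:c:]" for c
  proof -
    obtain N :: nat where "of_nat N - c\<^sup>2 \<in> quadratic_module G"
      using assms(1) unfolding archimedean_module_def by blast
    then have "[:of_nat N - c\<^sup>2:] \<in> M"
      using qgen_M const_poly_quadratic_module by blast
    moreover have "[:of_nat N - c\<^sup>2:] = [:Poly_Mapping.single 0 (real N):] - [:c:]\<^sup>2"
      by (simp add: power2_eq_square)
    ultimately show ?thesis
      unfolding mpoly_scalars.bounded_in_def by metis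
  qed
  \<comment> \<open>Monicity lets the top power of \<open>?Y\<close> stand alone, as
    \<open>bounded_in_integral\<close> requires.\<close>
  have "?\<chi> = (\<Sum>j\<le>CARD('t). monom (coeff ?\<chi> j) j)"
    by (rule poly_as_sum_of_monoms'[OF degree_char_poly, symmetric])
  also have "\<dots> = (\<Sum>j\<le>CARD('t). [:coeff ?\<chi> j:] * ?Y ^ j)"
    by (simp add: monom_altdef)
  also have "\<dots> = ?Y ^ CARD('t) + (\<Sum>j<CARD('t). [:coeff ?\<chi> j:] * ?Y ^ j)"
    by (simp add: monic_char_poly add.commute flip: lessThan_Suc_atMost)
  finally have \<chi>_eq: "?Y ^ CARD('t) + (\<Sum>j<CARD('t). [:coeff ?\<chi> j:] * ?Y ^ j) = ?\<chi>"
    by (rule sym)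
  have Y_bounded: "mpoly_scalars.bounded_in M ?Y"
    by (rule mpoly_scalars.bounded_in_integral[OF M,
          where n = "CARD('t)" and y = ?Y and b = "\<lambda>j. [:coeff ?\<chi> j:]"])
      (simp_all only: \<chi>_eq \<chi> const_bounded)
  \<comment> \<open>Bounded elements are closed under sums and products, and constants together with
    \<open>?Y\<close> generate the ring.\<close>
  have "mpoly_scalars.bounded_in M p" for p
  proof (induction p)
    case 0
    show ?case
      using const_bounded[of 0] by simp
  next
    case (pCons a p)
    have "pCons a p = [:a:] + ?Y * p"
      by simp
    then show ?case
      by (metis mpoly_scalars.bounded_in_add mpoly_scalars.bounded_in_mult M const_bounded Y_bounded pCons.IH)
  qed
  then have arch: "mpoly_scalars.archimedean M"
    by (rule mpoly_scalars.archimedeanI[OF M])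
  have "?Y \<in> M"
  proof (rule mpoly_scalars.positivstellensatz[OF M arch])
    fix \<alpha> assume hom: "mpoly_scalars.real_hom \<alpha>" and nonneg: "\<And>a. a \<in> M \<Longrightarrow> 0 \<le> \<alpha> a"
    \<comment> \<open>Nonnegativity on both \<open>?\<chi>\<close> and its negative forces the value
      zero.\<close>
    have "\<alpha> ?\<chi> = 0"
      using nonneg[OF \<chi>(1)] nonneg[OF \<chi>(2)] by (simp add: hom_uminus[OF hom])
    then have "real_eigenvalue (mpoly_matrix_eval f (hom_point \<alpha>)) (\<alpha> ?Y)"
      by (rule hom_eigenvalue[OF hom])
    moreover have "hom_point \<alpha> \<in> nonneg_set G"
      unfolding nonneg_set_def
    proof (intro CollectI ballI)
      fix g assume "g \<in> G"
      then have "[:g:] \<in> qgen ?B"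
        by (intro qgen_generator) simp
      then show "0 \<le> mpoly_eval g (hom_point \<alpha>)"
        using nonneg[of "[:g:]"] qgen_M by (auto simp only: hom_const[OF hom])
    qed
    ultimately show "0 < \<alpha> ?Y"
      using assms(2) by blast
  qed
  then obtain q where "q \<in> qgen ?B" "matrix_poly f ?Y = matrix_poly f q"
    by (auto simp: M_def)
  moreover have "matrix_poly f ?Y = f"
    by simp
  ultimately show ?thesis
    using matrix_poly_qgen by metis
qed

end
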